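(* Let $1\le p<q\le\infty$ and let $E$ be a $D$-convex r.i. space on $[0,1]$ that is an interpolation space for $(L_p,L_q)$. Then there exists a constant $c>0$ such that for every $x\in E$ with $\|x\|_E=1$ there exists an increasing, $p$-convex, $q$-concave function $M:[0,\infty)\to[0,\infty)$ such that $$\int_0^1M(|x|)\,ds\ge c^{-1},\quad\text{and}\quad\int_0^1M(|y|)\,ds\le c\ \text{ whenever }\ \|y\|_E\le c^{-1}.$$ Thus there exists a family of increasing, $p$-convex, $q$-concave functions $M_\alpha:[0,\infty)\to[0,\infty)$ ($\alpha\in A$) such that $\|\cdot\|_E$ is equivalent to $\sup_{\alpha\in A}\|\cdot\|_{L_{M_\alpha}}$.
   Context: For a measurable $x$ on $[0,1]$, $x^*$ is the decreasing rearrangement of $|x|$. A Banach space $E$ of measurable functions on $[0,1]$ is rearrangement invariant (r.i.) if $y\in E$ and $x^*\le y^*$ imply $x\in E$ and $\|x\|_E\le\|y\|_E$. Standing assumption: $E$ is maximal or minimal in the sense of Lindenstrauss and Tzafriri (e.g. separable or isometric to the dual of a separable r.i. space), so that $\lim_{t\to\infty}\|\min\{x,t\}\|_E=\|x\|_E$ for $0\le x\in E$. For functions $x_1,\dots,x_n$ on $[0,1]$ the dilated disjoint sum is $C(x_1,\dots,x_n)(t)=|x_k(nt-k+1)|$ for $(k-1)/n<t<k/n$. $E$ is $D$-convex if there is a constant $c>0$ such that $\|C(x_1,\dots,x_n)\|_E\le c\sup_{1\le k\le n}\|x_k\|_E$ for all $n$ and all $x_1,\dots,x_n$. $E$ is an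 interpolation space for $(L_p,L_q)$ if there is a constant $c>0$ such that whenever $T:L_p\cap L_q\to L_p\cap L_q$ is linear with $\|T\|_{L_p\to L_p}\le1$ and $\|T\|_{L_q\to L_q}\le1$, then $\|T\|_{E\to E}\le c$. An increasing $M:[0,\infty)\to[0,\infty)$ is $p$-convex if $t\mapsto M(t^{1/p})$ is convex, and $q$-concave if $t\mapsto-M(t^{1/q})$ is convex; every such $M$ is by convention $\infty$-concave. $\|x\|_{L_M}=\inf\{\lambda>0:\int_0^1M(|x(t)|/\lambda)\,dt\le1\}$. Equivalence of norms means two-sided domination up to a positive constant. *)

theory Defs
  imports "HOL-Analysis.Analysis" "HOL-Probability.Essential_Supremum"
begin

abbreviation unit_leb :: "real measure" where
  "unit_leb \<equiv> lebesgue_on {0..1}"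

text \<open>Function spaces on the unit interval are pairs \<open>(E, N)\<close>: a set of real-valued measurable
  functions together with a norm. Functions are not quotiented by almost everywhere equality; this
  enters through \<open>norm_eq_0_iff\<close> below, and in a rearrangement invariant space both \<open>E\<close> and \<open>N\<close>
  respect it automatically. Values of functions outside \<open>[0,1]\<close>, and of \<open>N\<close> outside \<open>E\<close>, play no
  role.\<close>

locale banach_function_space =
  fixes E :: "(real \<Rightarrow> real) set" and N :: "(real \<Rightarrow> real) \<Rightarrow> real"
  assumes measurable: "x \<in> E \<Longrightarrow> x \<in> borel_measurable unit_leb"
    and zero_mem: "(\<lambda>t. 0) \<in> E"
    and add_mem: "x \<in> E \<Longrightarrow> y \<in> E \<Longrightarrow> (\<lambda>t. x t + y t) \<in> E"
    and scale_mem: "x \<in> E \<Longrightarrow> (\<lambda>t. a * x t) \<in> E"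
    and norm_nonneg: "x \<in> E \<Longrightarrow> 0 \<le> N x"
    and norm_eq_0_iff: "x \<in> E \<Longrightarrow> N x = 0 \<longleftrightarrow> (AE t in unit_leb. x t = 0)"
    and norm_scale: "x \<in> E \<Longrightarrow> N (\<lambda>t. a * x t) = \<bar>a\<bar> * N x"
    and norm_triangle: "x \<in> E \<Longrightarrow> y \<in> E \<Longrightarrow> N (\<lambda>t. x t + y t) \<le> N x + N y"
    and complete:
      "(\<And>n. u n \<in> E) \<Longrightarrow>
       (\<And>e. 0 < e \<Longrightarrow> \<exists>K. \<forall>m\<ge>K. \<forall>n\<ge>K. N (\<lambda>t. u m t - u n t) < e) \<Longrightarrow>
       \<exists>x\<in>E. (\<lambda>n. N (\<lambda>t. u n t - x t)) \<longlonglongrightarrow> 0"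

text \<open>The infimum below is over a nonempty set only for \<open>s > 0\<close>: the value at \<open>0\<close> is not used.\<close>

definition decr_rearr :: "(real \<Rightarrow> real) \<Rightarrow> real \<Rightarrow> real" where
  "decr_rearr x s = Inf {l. 0 \<le> l \<and> measure unit_leb {t \<in> {0..1}. \<bar>x t\<bar> > l} \<le> s}"

locale ri_space = banach_function_space +
  assumes rearrangement_invariant:
    "y \<in> E \<Longrightarrow> x \<in> borel_measurable unit_leb \<Longrightarrow>
     (\<And>s. 0 < s \<Longrightarrow> s \<le> 1 \<Longrightarrow> decr_rearr x s \<le> decr_rearr y s) \<Longrightarrow>
     x \<in> E \<and> N x \<le> N y"

text \<open>The Koethe dual \<open>E'\<close> of \<open>(E, N)\<close> consists of the functions with finite dual norm. Maximality
  and minimality are those of Lindenstrauss and Tzafriri: \<open>E\<close> is isometrically either all of \<open>E''\<close>,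
  or the closure of the simple functions in \<open>E''\<close>.\<close>

definition kothe_enorm ::
    "(real \<Rightarrow> real) set \<Rightarrow> ((real \<Rightarrow> real) \<Rightarrow> real) \<Rightarrow> (real \<Rightarrow> real) \<Rightarrow> ennreal" where
  "kothe_enorm E N g = (SUP f\<in>{f\<in>E. N f \<le> 1}. \<integral>\<^sup>+ t. ennreal \<bar>f t * g t\<bar> \<partial>unit_leb)"

definition kothe_dual ::
    "(real \<Rightarrow> real) set \<Rightarrow> ((real \<Rightarrow> real) \<Rightarrow> real) \<Rightarrow> (real \<Rightarrow> real) set" where
  "kothe_dual E N = {g \<in> borel_measurable unit_leb. kothe_enorm E N g < \<infinity>}"

definition kothe_norm ::
    "(real \<Rightarrow> real) set \<Rightarrow> ((real \<Rightarrow> real) \<Rightarrow> real) \<Rightarrow> (real \<Rightarrow> real) \<Rightarrow> real" where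
  "kothe_norm E N g = enn2real (kothe_enorm E N g)"

definition kothe_bidual ::
    "(real \<Rightarrow> real) set \<Rightarrow> ((real \<Rightarrow> real) \<Rightarrow> real) \<Rightarrow> (real \<Rightarrow> real) set" where
  "kothe_bidual E N = kothe_dual (kothe_dual E N) (kothe_norm E N)"

definition kothe_binorm ::
    "(real \<Rightarrow> real) set \<Rightarrow> ((real \<Rightarrow> real) \<Rightarrow> real) \<Rightarrow> (real \<Rightarrow> real) \<Rightarrow> real" where
  "kothe_binorm E N = kothe_norm (kothe_dual E N) (kothe_norm E N)"

definition maximal_space :: "(real \<Rightarrow> real) set \<Rightarrow> ((real \<Rightarrow> real) \<Rightarrow> real) \<Rightarrow> bool" where
  "maximal_space E N \<longleftrightarrow> E = kothe_bidual E N \<and> (\<forall>x\<in>E. N x = kothe_binorm E N x)"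

definition minimal_space :: "(real \<Rightarrow> real) set \<Rightarrow> ((real \<Rightarrow> real) \<Rightarrow> real) \<Rightarrow> bool" where
  "minimal_space E N \<longleftrightarrow>
     E = {x \<in> kothe_bidual E N. \<forall>e>0. \<exists>s \<in> kothe_bidual E N.
            simple_function unit_leb s \<and> kothe_binorm E N (\<lambda>t. x t - s t) < e} \<and>
     (\<forall>x\<in>E. N x = kothe_binorm E N x)"

definition dilated_sum :: "nat \<Rightarrow> (nat \<Rightarrow> real \<Rightarrow> real) \<Rightarrow> real \<Rightarrow> real" where
  "dilated_sum n x t =
     (\<Sum>k=1..n. indicator {(real k - 1) / real n <..< real k / real n} t
                 * \<bar>x k (real n * t - real k + 1)\<bar>)"

definition D_convex :: "(real \<Rightarrow> real) set \<Rightarrow> ((real \<Rightarrow> real) \<Rightarrow> real) \<Rightarrow> bool" where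
  "D_convex E N \<longleftrightarrow>
     (\<exists>c>0. \<forall>n\<ge>1. \<forall>x. (\<forall>k\<in>{1..n}. x k \<in> E) \<longrightarrow>
        dilated_sum n x \<in> E \<and> N (dilated_sum n x) \<le> c * (SUP k\<in>{1..n}. N (x k)))"

definition Lp_space :: "ereal \<Rightarrow> (real \<Rightarrow> real) set" where
  "Lp_space p = {x \<in> borel_measurable unit_leb.
     if p = \<infinity> then esssup unit_leb (\<lambda>t. ereal \<bar>x t\<bar>) < \<infinity>
     else integrable unit_leb (\<lambda>t. \<bar>x t\<bar> powr real_of_ereal p)}"

definition Lp_norm :: "ereal \<Rightarrow> (real \<Rightarrow> real) \<Rightarrow> real" where
  "Lp_norm p x =
     (if p = \<infinity> then real_of_ereal (esssup unit_leb (\<lambda>t. ereal \<bar>x t\<bar>))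
      else (\<integral>t. \<bar>x t\<bar> powr real_of_ereal p \<partial>unit_leb) powr (1 / real_of_ereal p))"

text \<open>Operators act on representatives, so linearity is required almost everywhere; together with
  the norm bounds it makes \<open>T\<close> well defined on classes of almost everywhere equal functions.\<close>

definition linear_contraction :: "ereal \<Rightarrow> ereal \<Rightarrow> ((real \<Rightarrow> real) \<Rightarrow> real \<Rightarrow> real) \<Rightarrow> bool" where
  "linear_contraction p q T \<longleftrightarrow>
     (let L = Lp_space p \<inter> Lp_space q in
       (\<forall>x\<in>L. T x \<in> L) \<and>
       (\<forall>x\<in>L. \<forall>y\<in>L. AE t in unit_leb. T (\<lambda>s. x s + y s) t = T x t + T y t) \<and>
       (\<forall>a. \<forall>x\<in>L. AE t in unit_leb. T (\<lambda>s. a * x s) t = a * T x t) \<and>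
       (\<forall>x\<in>L. Lp_norm p (T x) \<le> Lp_norm p x) \<and>
       (\<forall>x\<in>L. Lp_norm q (T x) \<le> Lp_norm q x))"

text \<open>As \<open>T\<close> is only given on the intersection of the two Lebesgue spaces, its norm as an operator
  on \<open>E\<close> is taken over the elements of \<open>E\<close> in that intersection.\<close>

definition interpolation_space ::
    "(real \<Rightarrow> real) set \<Rightarrow> ((real \<Rightarrow> real) \<Rightarrow> real) \<Rightarrow> ereal \<Rightarrow> ereal \<Rightarrow> bool" where
  "interpolation_space E N p q \<longleftrightarrow>
     (\<exists>c>0. \<forall>T. linear_contraction p q T \<longrightarrow>
        (\<forall>x \<in> E \<inter> Lp_space p \<inter> Lp_space q. T x \<in> E \<and> N (T x) \<le> c * N x))"

definition p_convex :: "real \<Rightarrow> (real \<Rightarrow> real) \<Rightarrow> bool" where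
  "p_convex p M \<longleftrightarrow> convex_on {0..} (\<lambda>t. M (t powr (1 / p)))"

definition q_concave :: "ereal \<Rightarrow> (real \<Rightarrow> real) \<Rightarrow> bool" where
  "q_concave q M \<longleftrightarrow>
     q = \<infinity> \<or> convex_on {0..} (\<lambda>t. - M (t powr (1 / real_of_ereal q)))"

text \<open>Increasing functions \<open>M: [0,\<infinity>) \<rightarrow> [0,\<infinity>)\<close>, in the non-strict sense, normalised by
  \<open>M(0) = 0\<close> as usual for Orlicz functions. Without the normalisation a nonzero constant
  would qualify.\<close>

definition increasing_from_0 :: "(real \<Rightarrow> real) \<Rightarrow> bool" where
  "increasing_from_0 M \<longleftrightarrow> M 0 = 0 \<and> mono_on {0..} M \<and> (\<forall>t\<ge>0. 0 \<le> M t)"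

definition modular :: "(real \<Rightarrow> real) \<Rightarrow> (real \<Rightarrow> real) \<Rightarrow> ennreal" where
  "modular M x = (\<integral>\<^sup>+ t. ennreal (M \<bar>x t\<bar>) \<partial>unit_leb)"

definition luxemburg_norm :: "(real \<Rightarrow> real) \<Rightarrow> (real \<Rightarrow> real) \<Rightarrow> ennreal" where
  "luxemburg_norm M x = (INF l\<in>{l. 0 < l \<and> modular M (\<lambda>t. x t / l) \<le> 1}. ennreal l)"

end

theory Submission
  imports Defs
begin

text \<open>Write \<open>\<kappa>(z)\<close> for \<open>z\<^sup>q\<close> if \<open>z < 1\<close> (read as \<open>0\<close> when \<open>q = \<infinity>\<close>)
  and \<open>z\<^sup>p\<close> if \<open>z \<ge> 1\<close>. Replace \<open>x\<close> by a simple function \<open>s \<le> \<bar>x\<bar>/2\<close> whose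
  norm is still larger than \<open>1/4\<close>, with values \<open>c\<close> taken on sets of measure \<open>b\<^sub>c\<close>. A function \<open>y\<close> in a
  small ball of \<open>E\<close>, together with disjoint sets \<open>S\<^sub>c\<close>, provides the vector
  \<open>v\<^sub>c = \<integral>\<^bsub>S\<^sub>c\<^esub> \<kappa>(\<bar>y\<bar>/c)\<close>. Let \<open>V\<close> be the set of averages of such vectors.

  If \<open>b \<le> 2v\<close> for some \<open>v\<close> in \<open>V\<close>, then \<open>D\<close>-convexity realises \<open>v\<close> by a single \<open>Y\<close>, and an explicit
  contraction of \<open>L\<^sub>p\<close> and \<open>L\<^sub>q\<close> maps \<open>Y\<close> to \<open>s/2\<close>, so interpolation makes \<open>N s\<close> too small. Otherwise \<open>b\<close>
  has positive distance from \<open>V\<close> and is separated from it by nonnegative weights \<open>w\<close>. Choosing the best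
  sets \<open>S\<^sub>c\<close> for a given \<open>y\<close> turns the separation into a modular inequality for
  \<open>M(t) = max\<^sub>c w\<^sub>c \<kappa>(t/c)\<close>. As \<open>M(t)/t\<^sup>p\<close> increases and \<open>M(t)/t\<^sup>q\<close> decreases, \<open>M\<close> is equivalent to the
  \<open>p\<close>-convex and \<open>q\<close>-concave function \<open>\<integral>\<^sub>0\<^sup>t M(r)/r dr\<close>.\<close>

subsection \<open>Separation from a midpoint convex set\<close>

text \<open>The nearest point to \<open>b\<close> is replaced by a minimising sequence for the squared positive part of
  \<open>b - v\<close>, which is Cauchy by the parallelogram law. Taking positive parts makes the weights nonnegative.\<close>

lemma midpoint_separation:
  fixes V :: "('i \<Rightarrow> real) set" and b :: "'i \<Rightarrow> real"
  assumes J: "finite J" and zero: "(\<lambda>i. 0) \<in> V"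
    and mid: "\<And>u v. u \<in> V \<Longrightarrow> v \<in> V \<Longrightarrow> (\<lambda>i. (u i + v i) / 2) \<in> V"
    and e: "0 < e" and far: "\<And>v. v \<in> V \<Longrightarrow> \<exists>i\<in>J. v i \<le> b i - e"
  shows "\<exists>w. (\<forall>i. 0 \<le> w i) \<and> (\<Sum>i\<in>J. w i * b i) = 1 \<and> (\<forall>v\<in>V. (\<Sum>i\<in>J. w i * v i) \<le> 1)"
proof -
  define P where "P v i = max (b i - v i) 0" for v i
  define f where "f v = (\<Sum>i\<in>J. (P v i)\<^sup>2)" for v
  define d where "d = Inf (f ` V)"
  have bdd: "bdd_below (f ` V)"
    by (rule bdd_belowI2[of _ 0]) (simp add: f_def sum_nonneg)
  have dle: "d \<le> f v" if "v \<in> V" for v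
    unfolding d_def using bdd that by (simp add: cINF_lower)
  have fe: "e\<^sup>2 \<le> f v" if "v \<in> V" for v
  proof -
    obtain i where i: "i \<in> J" "v i \<le> b i - e" using far[OF \<open>v \<in> V\<close>] by blast
    have "e\<^sup>2 \<le> (P v i)\<^sup>2" using i e by (intro power_mono) (auto simp: P_def)
    also have "\<dots> \<le> f v" unfolding f_def
      using J i by (intro member_le_sum) auto
    finally show ?thesis .
  qed
  have "e\<^sup>2 \<le> d" unfolding d_def using zero fe by (intro cINF_greatest) auto
  then have dpos: "0 < d" using e by (smt (verit) zero_less_power)
  have "\<exists>v\<in>V. f v < d + 1 / real (Suc n)" for n
  proof -
    have "Inf (f ` V) < d + 1 / real (Suc n)" by (simp add: d_def)
    then show ?thesis using cInf_lessD[of "f ` V"] zero by blast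
  qed
  then obtain v where v: "\<And>n. v n \<in> V" "\<And>n. f (v n) < d + 1 / real (Suc n)" by metis
  have par: "(P (v n) i - P (v m) i)\<^sup>2 \<le> 2 / real (Suc n) + 2 / real (Suc m)" if i: "i \<in> J" for n m i
  proof -
    \<comment> \<open>The midpoint lies in \<open>V\<close>, and its positive part is at most the
      mean of the two positive parts, so the mean also has squared norm at least
      \<open>d\<close>.\<close>
    have "d \<le> f (\<lambda>i. (v n i + v m i) / 2)" by (intro dle mid v)
    also have "\<dots> \<le> (\<Sum>i\<in>J. ((P (v n) i + P (v m) i) / 2)\<^sup>2)"
      unfolding f_def by (intro sum_mono power_mono) (auto simp: P_def max_def field_simps)
    finally have 1: "d \<le> (\<Sum>i\<in>J. ((P (v n) i + P (v m) i) / 2)\<^sup>2)" .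
    have "(\<Sum>i\<in>J. ((P (v n) i - P (v m) i) / 2)\<^sup>2)
        = f (v n) / 2 + f (v m) / 2 - (\<Sum>i\<in>J. ((P (v n) i + P (v m) i) / 2)\<^sup>2)"
      unfolding f_def sum_divide_distrib sum.distrib[symmetric] sum_subtractf[symmetric]
      by (intro sum.cong) (auto simp: power2_eq_square field_simps)
    also have "\<dots> \<le> (1 / real (Suc n) + 1 / real (Suc m)) / 2" using 1 v(2)[of n] v(2)[of m]
      by argo
    finally have 2: "(\<Sum>i\<in>J. ((P (v n) i - P (v m) i) / 2)\<^sup>2) \<le> (1 / real (Suc n) + 1 / real (Suc m)) / 2" .
    have "((P (v n) i - P (v m) i) / 2)\<^sup>2 \<le> (\<Sum>i\<in>J. ((P (v n) i - P (v m) i) / 2)\<^sup>2)"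
      using J i by (intro member_le_sum[where f = "\<lambda>i. ((P (v n) i - P (v m) i) / 2)\<^sup>2"]) auto
    with 2 have "((P (v n) i - P (v m) i) / 2)\<^sup>2 \<le> (1 / real (Suc n) + 1 / real (Suc m)) / 2" by linarith
    then show ?thesis unfolding power_divide by (simp del: of_nat_Suc)
  qed
  have "Cauchy (\<lambda>n. P (v n) i)" if i: "i \<in> J" for i
  proof (rule metric_CauchyI)
    fix \<epsilon> :: real assume "0 < \<epsilon>"
    then obtain K where K: "1 / real (Suc K) < \<epsilon>\<^sup>2 / 4" 
      using nat_approx_posE[of "\<epsilon>\<^sup>2 / 4"] by (auto simp: zero_less_power)
    show "\<exists>M. \<forall>m\<ge>M. \<forall>n\<ge>M. dist (P (v m) i) (P (v n) i) < \<epsilon>"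
    proof (intro exI[of _ K] allI impI)
      fix m n assume mn: "K \<le> m" "K \<le> n"
      have "1 / real (Suc m) \<le> 1 / real (Suc K)" "1 / real (Suc n) \<le> 1 / real (Suc K)"
        using mn by (auto simp: frac_le)
      then have "(P (v m) i - P (v n) i)\<^sup>2 < \<epsilon>\<^sup>2" using par[OF i, of m n] K by simp
      then show "dist (P (v m) i) (P (v n) i) < \<epsilon>" using \<open>0 < \<epsilon>\<close>
        unfolding dist_real_def by (simp add: abs_square_less_1 power2_less_imp_less abs_le_square_iff)
    qed
  qed
  then have "\<exists>l. (\<lambda>n. P (v n) i) \<longlonglongrightarrow> l" if "i \<in> J" for i
    using that by (simp add: Cauchy_convergent_iff convergent_def)
  then obtain l where l: "\<And>i. i \<in> J \<Longrightarrow> (\<lambda>n. P (v n) i) \<longlonglongrightarrow> l i" by metis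
  \<comment> \<open>On \<open>J\<close> the limits are already nonnegative; the maximum only serves
    indices outside \<open>J\<close>, where \<open>l\<close> is arbitrary.\<close>
  define w where "w i = max (l i) 0" for i
  have wl: "w i = l i" if "i \<in> J" for i
    using LIMSEQ_le_const[OF l[OF that], of 0] by (auto simp: w_def P_def)
  have w: "(\<lambda>n. P (v n) i) \<longlonglongrightarrow> w i" if "i \<in> J" for i
    using l[OF that] wl[OF that] by simp
  have "(\<lambda>n. f (v n)) \<longlonglongrightarrow> d"
  proof (rule tendsto_sandwich[of "\<lambda>n. d" _ _ "\<lambda>n. d + 1 / real (Suc n)"])
    show "(\<lambda>n. d + 1 / real (Suc n)) \<longlonglongrightarrow> d"
      using tendsto_add[OF tendsto_const LIMSEQ_Suc[OF lim_1_over_n], of d] by simp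
  qed (use dle v in \<open>auto intro!: always_eventually less_imp_le\<close>)
  moreover have "(\<lambda>n. f (v n)) \<longlonglongrightarrow> (\<Sum>i\<in>J. (w i)\<^sup>2)"
    unfolding f_def by (intro tendsto_sum tendsto_power w)
  ultimately have dw: "(\<Sum>i\<in>J. (w i)\<^sup>2) = d" using LIMSEQ_unique by blast
  \<comment> \<open>First-order optimality: moving from the minimising sequence towards
    \<open>u\<close> cannot push the squared distance below \<open>d\<close>.\<close>
  have key: "(\<Sum>i\<in>J. w i * u i) \<le> (\<Sum>i\<in>J. w i * b i) - d" if u: "u \<in> V" for u
  proof -
    define z where "z i = b i - u i - w i" for i
    \<comment> \<open>Repeated halving reaches the weights \<open>1/2^m\<close>; these tend to 0,
      which is enough for a derivative at the minimum.\<close>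
    have mem: "(\<lambda>i. (1 - 1/2^m) * v n i + 1/2^m * u i) \<in> V" for m n
    proof (induction m)
      case 0 then show ?case using u by simp
    next
      case (Suc m)
      from mid[OF v(1)[of n] this] show ?case
        by (rule back_subst[of "\<lambda>x. x \<in> V"]) (auto simp: field_simps)
    qed
    \<comment> \<open>In the limit over \<open>n\<close>, minimality says that
      \<open>w + t z\<close> has squared norm at least \<open>d\<close>, which is the squared norm
      of \<open>w\<close>. Cancelling \<open>d\<close> and dividing by \<open>t\<close> leaves this
      bound.\<close>
    have quad: "0 \<le> 2 * (\<Sum>i\<in>J. w i * z i) + 1/2^m * (\<Sum>i\<in>J. (z i)\<^sup>2)" for m
    proof -
      define t :: real where "t = 1/2^m"
      have t: "0 < t" "t \<le> 1" by (auto simp: t_def)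
      have "d \<le> (\<Sum>i\<in>J. ((1 - t) * P (v n) i + t * (b i - u i))\<^sup>2)" for n
      proof -
        have "d \<le> f (\<lambda>i. (1 - t) * v n i + t * u i)" using dle mem unfolding t_def by blast
        also have "\<dots> \<le> (\<Sum>i\<in>J. ((1 - t) * P (v n) i + t * (b i - u i))\<^sup>2)"
          unfolding f_def
        proof (rule sum_mono)
          fix i
          have "(1 - t) * (b i - v n i) \<le> (1 - t) * P (v n) i"
            using t by (intro mult_left_mono) (auto simp: P_def)
          then have "b i - ((1 - t) * v n i + t * u i) \<le> (1 - t) * P (v n) i + t * (b i - u i)"
            by (simp add: algebra_simps)
          then show "(P (\<lambda>i. (1 - t) * v n i + t * u i) i)\<^sup>2 \<le> ((1 - t) * P (v n) i + t * (b i - u i))\<^sup>2"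
            unfolding P_def by (subst abs_le_square_iff[symmetric]) auto
        qed
        finally show ?thesis .
      qed
      moreover have "(\<lambda>n. \<Sum>i\<in>J. ((1 - t) * P (v n) i + t * (b i - u i))\<^sup>2)
          \<longlonglongrightarrow> (\<Sum>i\<in>J. ((1 - t) * w i + t * (b i - u i))\<^sup>2)"
        by (intro tendsto_intros w)
      ultimately have "d \<le> (\<Sum>i\<in>J. ((1 - t) * w i + t * (b i - u i))\<^sup>2)"
        by (meson LIMSEQ_le_const)
      also have "\<dots> = (\<Sum>i\<in>J. (w i)\<^sup>2 + t * (2 * (w i * z i)) + t * (t * (z i)\<^sup>2))"
        by (intro sum.cong) (auto simp: z_def power2_eq_square algebra_simps)
      also have "\<dots> = d + t * (2 * (\<Sum>i\<in>J. w i * z i) + t * (\<Sum>i\<in>J. (z i)\<^sup>2))"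
        unfolding sum.distrib dw by (simp add: sum_distrib_left algebra_simps)
      finally show ?thesis using t unfolding t_def[symmetric] by (simp add: zero_le_mult_iff)
    qed
    have "(\<lambda>m. 2 * (\<Sum>i\<in>J. w i * z i) + (1/2)^m * (\<Sum>i\<in>J. (z i)\<^sup>2)) \<longlonglongrightarrow> 2 * (\<Sum>i\<in>J. w i * z i) + 0 * (\<Sum>i\<in>J. (z i)\<^sup>2)"
      by (intro tendsto_intros LIMSEQ_realpow_zero) auto
    then have "0 \<le> (\<Sum>i\<in>J. w i * z i)" using LIMSEQ_le_const[of _ _ 0] quad
      by (force simp: power_one_over)
    also have "\<dots> = (\<Sum>i\<in>J. w i * b i) - (\<Sum>i\<in>J. w i * u i) - d"
      unfolding z_def dw[symmetric] sum_subtractf[symmetric]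
      by (intro sum.cong) (auto simp: power2_eq_square algebra_simps)
    finally show ?thesis by simp
  qed
  \<comment> \<open>The optimality condition at the zero vector gives \<open>s \<ge> d > 0\<close>,
    so the weights can be normalised by \<open>s\<close>.\<close>
  define s where "s = (\<Sum>i\<in>J. w i * b i)"
  have s: "0 < s" using key[OF zero] dpos by (simp add: s_def)
  have sum_div: "(\<Sum>i\<in>J. w i / s * a i) = (\<Sum>i\<in>J. w i * a i) / s" for a
    by (simp add: sum_divide_distrib)
  show ?thesis
  proof (intro exI[of _ "\<lambda>i. w i / s"] conjI ballI allI)
    show "0 \<le> w i / s" for i using s by (simp add: w_def)
    show "(\<Sum>i\<in>J. w i / s * b i) = 1" using s by (simp only: sum_div) (simp add: s_def)
    show "(\<Sum>i\<in>J. w i / s * u i) \<le> 1" if "u \<in> V" for u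
      using key[OF that] dpos s by (simp only: sum_div) (simp add: s_def)
  qed
qed

text \<open>Repeating each list as often as the other has entries makes both parts equally long, so
  their joint average is the midpoint. Averages of lists have equal weights, which is the form that
  \<open>D\<close>-convexity can realise.\<close>

lemma averages_midpoint:
  fixes B :: "('i \<Rightarrow> real) set"
  defines "V \<equiv> {v. \<exists>L. L \<noteq> [] \<and> set L \<subseteq> B \<and> v = (\<lambda>i. (\<Sum>a\<leftarrow>L. a i) / real (length L))}"
  assumes "u \<in> V" "v \<in> V"
  shows "(\<lambda>i. (u i + v i) / 2) \<in> V"
proof -
  obtain K L where K: "K \<noteq> []" "set K \<subseteq> B" "u = (\<lambda>i. (\<Sum>a\<leftarrow>K. a i) / real (length K))"
    and L: "L \<noteq> []" "set L \<subseteq> B" "v = (\<lambda>i. (\<Sum>a\<leftarrow>L. a i) / real (length L))"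
    using assms by auto
  define H where "H = concat (replicate (length L) K) @ concat (replicate (length K) L)"
  have len: "length (concat (replicate n M)) = n * length M" for n and M :: "('i \<Rightarrow> real) list"
    by (induction n) auto
  have sum: "(\<Sum>a\<leftarrow>concat (replicate n M). a i) = real n * (\<Sum>a\<leftarrow>M. a i)"
    for n i and M :: "('i \<Rightarrow> real) list"
    by (induction n) (auto simp: algebra_simps)
  have "H \<noteq> []" using K L by (auto simp: H_def)
  moreover have "set H \<subseteq> B" using K L by (auto simp: H_def)
  moreover have "(\<lambda>i. (u i + v i) / 2) = (\<lambda>i. (\<Sum>a\<leftarrow>H. a i) / real (length H))"
    using K L by (auto simp: H_def len sum field_simps)
  ultimately show ?thesis unfolding V_def by blast
qed

subsection \<open>Regularisation of functions with power growth\<close>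

text \<open>A supporting line at the combined point, averaged over the two endpoints, gives
  convexity. Lines at positive points suffice because 0 is extreme: a proper combination equal to 0
  has both endpoints 0.\<close>

lemma convex_on_half_line_support:
  fixes f :: "real \<Rightarrow> real"
  assumes "\<And>u. 0 < u \<Longrightarrow> \<exists>K. \<forall>v\<ge>0. f u + K * (v - u) \<le> f v"
  shows "convex_on {0..} f"
proof (rule convex_onI)
  fix t x y :: real assume t: "0 < t" "t < 1" and xy: "x \<in> {0..}" "y \<in> {0..}"
  define c where "c = (1 - t) * x + t * y"
  have "f c \<le> (1 - t) * f x + t * f y"
  proof (cases "c = 0")
    case True
    have "0 \<le> (1 - t) * x" "0 \<le> t * y" using t xy by auto
    then have "(1 - t) * x = 0" "t * y = 0" using True unfolding c_def by linarith+
    then have "x = 0" "y = 0" using t by auto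
    then show ?thesis using True by (simp add: algebra_simps)
  next
    case False
    have "0 \<le> c" using t xy by (simp add: c_def)
    with False obtain K where K: "\<And>v. 0 \<le> v \<Longrightarrow> f c + K * (v - c) \<le> f v"
      using assms[of c] by auto
    have "(1 - t) * (f c + K * (x - c)) + t * (f c + K * (y - c)) \<le> (1 - t) * f x + t * f y"
      using K t xy by (intro add_mono mult_left_mono) auto
    then show ?thesis by (simp add: c_def algebra_simps)
  qed
  then show "f ((1 - t) *\<^sub>R x + t *\<^sub>R y) \<le> (1 - t) * f x + t * f y" by (simp add: c_def)
qed simp

lemma has_integral_powr_diff:
  fixes a s m :: real
  assumes "1 \<le> a" "0 \<le> s" "s \<le> m"
  shows "((\<lambda>r. r powr (a - 1)) has_integral (m powr a - s powr a) / a) {s..m}"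
proof -
  have "((\<lambda>r. r powr (a - 1)) has_integral (m powr a / a - s powr a / a)) {s..m}"
  proof (rule fundamental_theorem_of_calculus_interior)
    show "continuous_on {s..m} (\<lambda>r. r powr a / a)"
      using assms by (intro continuous_intros continuous_on_powr') auto
    fix x assume "x \<in> {s<..<m}"
    then show "((\<lambda>r. r powr a / a) has_vector_derivative x powr (a - 1)) (at x)"
      using assms unfolding has_real_derivative_iff_has_vector_derivative[symmetric]
      by (auto intro!: derivative_eq_intros)
  qed (use assms in auto)
  then show ?thesis by (simp add: diff_divide_distrib)
qed

text \<open>The regularisation is \<open>s \<mapsto> \<integral>\<^sub>0\<^sup>s M(r)/r dr\<close>: written in the variable \<open>s\<^sup>p\<close> or \<open>s\<^sup>q\<close> its
  integrand becomes \<open>M(s)/s\<^sup>p\<close> or \<open>M(s)/s\<^sup>q\<close> up to a constant, which is monotone.\<close>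

lemma p_convex_q_concave_regularisation:
  fixes M :: "real \<Rightarrow> real" and p :: real and q :: ereal
  assumes p: "1 \<le> p" and pq: "ereal p < q"
    and M0: "M 0 = 0" and nn: "\<And>s. 0 \<le> s \<Longrightarrow> 0 \<le> M s"
    and pg: "\<And>s t. 0 < s \<Longrightarrow> s \<le> t \<Longrightarrow> M s * t powr p \<le> M t * s powr p"
    and qg: "\<And>s t. q \<noteq> \<infinity> \<Longrightarrow> 0 < s \<Longrightarrow> s \<le> t \<Longrightarrow>
      M t * s powr real_of_ereal q \<le> M s * t powr real_of_ereal q"
  obtains L where "increasing_from_0 L" "p_convex p L" "q_concave q L"
    "\<And>s. 0 \<le> s \<Longrightarrow> M (s / 2) \<le> L s" "\<And>s. 0 \<le> s \<Longrightarrow> L s \<le> M s"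
proof -
  define \<phi> where "\<phi> r = M r / r" for r
  define L where "L s = integral {0..s} \<phi>" for s
  have \<phi>nn: "0 \<le> \<phi> r" if "0 \<le> r" for r using nn that by (simp add: \<phi>_def)
  \<comment> \<open>As \<open>p \<ge> 1\<close>, growth of \<open>M r / r powr p\<close> implies
    growth of \<open>M r / r\<close>. This gives integrability and, later, the comparison of
    \<open>L\<close> with \<open>M\<close>. At 0 division by zero gives the value 0.\<close>
  have \<phi>mono: "mono_on {0..} \<phi>"
  proof (rule mono_onI)
    fix s t :: real assume st: "s \<in> {0..}" "t \<in> {0..}" "s \<le> t"
    show "\<phi> s \<le> \<phi> t"
    proof (cases "s = 0")
      case True then show ?thesis using \<phi>nn st by (simp add: \<phi>_def M0)
    next
      case False
      with st have s: "0 < s" "0 < t" by auto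
      have "M s \<le> M t * (s / t) powr p"
        using pg[of s t] s st by (simp add: powr_divide field_simps)
      also have "\<dots> \<le> M t * (s / t) powr 1"
        using s st p nn by (intro mult_left_mono powr_mono') auto
      finally show ?thesis using s by (simp add: \<phi>_def field_simps)
    qed
  qed
  have int: "\<phi> integrable_on {s..t}" if "0 \<le> s" for s t
    by (intro integrable_on_mono_on mono_on_subset[OF \<phi>mono]) (use that in auto)
  have split: "L t - L s = integral {s..t} \<phi>" if "0 \<le> s" "s \<le> t" for s t
    using Henstock_Kurzweil_Integration.integral_combine[OF that int] unfolding L_def by simp
  \<comment> \<open>Comparison of \<open>M\<close> with a pure power on an interval: exponents
    \<open>p\<close> and \<open>q\<close> yield the supporting lines, exponent 1 the comparison of
    \<open>L\<close> with \<open>M\<close>.\<close>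
  have upper: "L t - L s \<le> C * ((t powr a - s powr a) / a)"
    if "1 \<le> a" "0 \<le> s" "s \<le> t" and C: "\<And>r. s \<le> r \<Longrightarrow> r \<le> t \<Longrightarrow> 0 < r \<Longrightarrow> M r \<le> C * r powr a" for a s t C
  proof -
    have "integral {s..t} \<phi> \<le> C * ((t powr a - s powr a) / a)"
    proof (rule has_integral_le[OF integrable_integral])
      show "((\<lambda>r. C * r powr (a - 1)) has_integral C * ((t powr a - s powr a) / a)) {s..t}"
        by (intro has_integral_mult_right has_integral_powr_diff that)
      fix r assume r: "r \<in> {s..t}"
      show "\<phi> r \<le> C * r powr (a - 1)"
      proof (cases "r = 0")
        case True then show ?thesis by (simp add: \<phi>_def)
      next
        case False
        with r that have "0 < r" by auto
        then show ?thesis using C[of r] r by (simp add: \<phi>_def powr_diff field_simps)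
      qed
    qed (use int that in auto)
    then show ?thesis using split that by simp
  qed
  have lower: "C * ((t powr a - s powr a) / a) \<le> L t - L s"
    if "1 \<le> a" "0 \<le> s" "s \<le> t" and C: "\<And>r. s \<le> r \<Longrightarrow> r \<le> t \<Longrightarrow> 0 < r \<Longrightarrow> C * r powr a \<le> M r" for a s t C
  proof -
    have "C * ((t powr a - s powr a) / a) \<le> integral {s..t} \<phi>"
    proof (rule has_integral_le[OF _ integrable_integral])
      show "((\<lambda>r. C * r powr (a - 1)) has_integral C * ((t powr a - s powr a) / a)) {s..t}"
        by (intro has_integral_mult_right has_integral_powr_diff that)
      fix r assume r: "r \<in> {s..t}"
      show "C * r powr (a - 1) \<le> \<phi> r"
      proof (cases "r = 0")
        case True then show ?thesis by (simp add: \<phi>_def)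
      next
        case False
        with r that have "0 < r" by auto
        then show ?thesis using C[of r] r by (simp add: \<phi>_def powr_diff field_simps)
      qed
    qed (use int that in auto)
    then show ?thesis using split that by simp
  qed
  have L0: "L 0 = 0" by (simp add: L_def)
  have Lmono: "L s \<le> L t" if "0 \<le> s" "s \<le> t" for s t
  proof -
    have "0 \<le> integral {s..t} \<phi>" using that by (intro integral_nonneg int) (auto simp: \<phi>nn)
    then show ?thesis using split[OF that] by simp
  qed
  have inc: "increasing_from_0 L"
    unfolding increasing_from_0_def using L0 Lmono[of 0] by (auto intro!: mono_onI Lmono)
  have pc: "p_convex p L" unfolding p_convex_def
  proof (rule convex_on_half_line_support)
    fix u :: real assume u: "0 < u"
    define m where "m = u powr (1 / p)"
    \<comment> \<open>Formally \<open>K / p\<close> is the slope of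
      \<open>v \<mapsto> L (v powr (1 / p))\<close> at \<open>u\<close>. Since
      \<open>M r / r powr p\<close> increases, it is at most \<open>K\<close> to the left of
      \<open>m\<close> and at least \<open>K\<close> to the right.\<close>
    define K where "K = M m / m powr p"
    have m: "0 < m" "m powr p = u" using u p by (auto simp: m_def powr_powr)
    have "L m + K / p * (v - u) \<le> L (v powr (1 / p))" if v: "0 \<le> v" for v
    proof -
      define s where "s = v powr (1 / p)"
      have s: "0 \<le> s" "s powr p = v" using v p by (auto simp: s_def powr_powr)
      show ?thesis unfolding s_def[symmetric]
      proof (cases "m \<le> s")
        case True
        have "K * ((s powr p - m powr p) / p) \<le> L s - L m"
          using m True pg p by (intro lower) (auto simp: K_def field_simps)
        then show "L m + K / p * (v - u) \<le> L s" using s m by simp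
      next
        case False
        have "L m - L s \<le> K * ((m powr p - s powr p) / p)"
          using m False pg[where t = m] s p by (intro upper) (auto simp: K_def field_simps)
        also have "\<dots> = - (K / p * (v - u))" using s m by (simp add: diff_divide_distrib algebra_simps)
        finally show "L m + K / p * (v - u) \<le> L s" by linarith
      qed
    qed
    then show "\<exists>K. \<forall>v\<ge>0. L (u powr (1 / p)) + K * (v - u) \<le> L (v powr (1 / p))"
      unfolding m_def by blast
  qed
  have qc: "q_concave q L" unfolding q_concave_def
  proof (cases "q = \<infinity>")
    case False
    define q' where "q' = real_of_ereal q"
    have q: "1 \<le> q'" using pq p False by (cases q) (auto simp: q'_def)
    note qg' = qg[OF False, folded q'_def]
    have "convex_on {0..} (\<lambda>t. - L (t powr (1 / q')))"
    proof (rule convex_on_half_line_support)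
      fix u :: real assume u: "0 < u"
      define m where "m = u powr (1 / q')"
      \<comment> \<open>The same slope with \<open>q'\<close>; here the quotient decreases, so both
        comparisons are reversed.\<close>
      define K where "K = M m / m powr q'"
      have m: "0 < m" "m powr q' = u" using u q by (auto simp: m_def powr_powr)
      have "- L m + - (K / q') * (v - u) \<le> - L (v powr (1 / q'))" if v: "0 \<le> v" for v
      proof -
        define s where "s = v powr (1 / q')"
        have s: "0 \<le> s" "s powr q' = v" using v q by (auto simp: s_def powr_powr)
        show ?thesis unfolding s_def[symmetric]
        proof (cases "m \<le> s")
          case True
          have "L s - L m \<le> K * ((s powr q' - m powr q') / q')"
            using m True qg' q by (intro upper) (auto simp: K_def field_simps)
          then show "- L m + - (K / q') * (v - u) \<le> - L s" using s m by simp
        next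
          case False
          have "K * ((m powr q' - s powr q') / q') \<le> L m - L s"
            using m False qg'[where t = m] s q by (intro lower) (auto simp: K_def field_simps)
          moreover have "K * ((m powr q' - s powr q') / q') = - (K / q' * (v - u))"
            using s m by (simp add: diff_divide_distrib algebra_simps)
          ultimately show "- L m + - (K / q') * (v - u) \<le> - L s" by linarith
        qed
      qed
      then show "\<exists>K. \<forall>v\<ge>0. - L (u powr (1 / q')) + K * (v - u) \<le> - L (v powr (1 / q'))"
        unfolding m_def by blast
    qed
    then show "q = \<infinity> \<or> convex_on {0..} (\<lambda>t. - L (t powr (1 / real_of_ereal q)))"
      by (simp add: q'_def)
  qed simp
  have \<phi>le: "M r * s \<le> M s * r" if "0 < r" "r \<le> s" for r s
    using mono_onD[OF \<phi>mono, of r s] that by (simp add: \<phi>_def field_simps)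
  have le: "L s \<le> M s" if "0 \<le> s" for s
  proof -
    have "L s - L 0 \<le> (M s / s) * ((s powr 1 - 0 powr 1) / 1)"
      by (rule upper) (use that \<phi>le in \<open>auto simp: field_simps\<close>)
    then show ?thesis using that L0 by (cases "s = 0") (auto simp: M0)
  qed
  have ge: "M (s / 2) \<le> L s" if "0 \<le> s" for s
  proof -
    define m where "m = s / 2"
    have m: "0 \<le> m" "s = 2 * m" using that by (auto simp: m_def)
    \<comment> \<open>On \<open>[m, 2 * m]\<close> the integrand is at least \<open>M m / m\<close>,
      and the interval has length \<open>m\<close>.\<close>
    have "(M m / m) * ((s powr 1 - m powr 1) / 1) \<le> L s - L m"
      by (rule lower) (use m nn \<phi>le[of m] in \<open>auto simp: divide_le_eq not_le M0\<close>)
    moreover have "(M m / m) * ((s powr 1 - m powr 1) / 1) = M m"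
      using m by (cases "m = 0") (simp_all add: M0)
    ultimately have "M m \<le> L s - L m" by linarith
    moreover have "0 \<le> L m" using Lmono[of 0 m] m(1) L0 by simp
    ultimately have "M m \<le> L s" by linarith
    then show ?thesis by (simp only: m_def)
  qed
  show thesis using that inc pc qc ge le by blast
qed

subsection \<open>The kernel and Lebesgue spaces\<close>

text \<open>For \<open>s \<ge> 0\<close> and finite \<open>q > p\<close> this is the minimum of
  \<open>s powr p\<close> and \<open>s powr q\<close>; the case \<open>q = \<infinity>\<close> is
  its pointwise limit, with a jump at 1.\<close>

definition kernel :: "real \<Rightarrow> ereal \<Rightarrow> real \<Rightarrow> real" where
  "kernel p q s = (if s < 1 then (if q = \<infinity> then 0 else s powr real_of_ereal q) else s powr p)"

lemma kernel_nonneg: "0 \<le> kernel p q s"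
  by (simp add: kernel_def)

lemma kernel_0 [simp]: "kernel p q 0 = 0"
  by (simp add: kernel_def)

lemma kernel_1 [simp]: "kernel p q 1 = 1"
  by (simp add: kernel_def)

lemma measurable_kernel [measurable]: "kernel p q \<in> borel_measurable borel"
  unfolding kernel_def by measurable

lemma kernel_le_powr_p:
  assumes "ereal p < q" "0 \<le> s"
  shows "kernel p q s \<le> s powr p"
  using assms by (cases q) (auto simp: kernel_def intro: powr_mono')

lemma kernel_le_powr_q:
  assumes "ereal p < q" "q \<noteq> \<infinity>" "0 \<le> s"
  shows "kernel p q s \<le> s powr real_of_ereal q"
  using assms by (cases q) (auto simp: kernel_def intro: powr_mono)

text \<open>Divided by \<open>s powr p\<close> the kernel is \<open>s powr (q - p)\<close> below 1
  (0 when \<open>q\<close> is infinite) and the constant 1 from 1 on, hence increasing.\<close>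

lemma kernel_growth_p:
  assumes "ereal p < q" "0 < s" "s \<le> t"
  shows "kernel p q s * t powr p \<le> kernel p q t * s powr p"
proof (cases "t < 1")
  case False
  then show ?thesis using kernel_le_powr_p[OF assms(1), of s] assms by (simp add: kernel_def mult.commute mult_right_mono)
next
  case True
  show ?thesis
  proof (cases q)
    case (real r)
    have "s powr (r - p) \<le> t powr (r - p)" using assms real by (intro powr_mono2) auto
    then have "s powr (r - p) * (s powr p * t powr p) \<le> t powr (r - p) * (s powr p * t powr p)"
      by (intro mult_right_mono) auto
    then show ?thesis using True assms real by (simp add: kernel_def powr_diff field_simps)
  qed (use True assms in \<open>auto simp: kernel_def\<close>)
qed

text \<open>Divided by \<open>s powr q\<close> the kernel is 1 below 1 and
  \<open>s powr (p - q)\<close> from 1 on, hence decreasing.\<close>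

lemma kernel_growth_q:
  assumes "ereal p < q" "q \<noteq> \<infinity>" "0 < s" "s \<le> t"
  shows "kernel p q t * s powr real_of_ereal q \<le> kernel p q s * t powr real_of_ereal q"
proof (cases "s < 1")
  case True
  then show ?thesis using kernel_le_powr_q[OF assms(1,2), of t] assms
    by (simp add: kernel_def mult.commute mult_right_mono)
next
  case False
  obtain r where r: "q = ereal r" using assms by (cases q) auto
  have "s powr (r - p) \<le> t powr (r - p)" using assms r by (intro powr_mono2) auto
  then have "s powr (r - p) * (s powr p * t powr p) \<le> t powr (r - p) * (s powr p * t powr p)"
    by (intro mult_right_mono) auto
  then show ?thesis using False assms r by (simp add: kernel_def powr_diff field_simps)
qed

section \<open>Jensen's inequality for powers\<close>

lemma powr_above_tangent:
  fixes a p r :: real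
  assumes "1 \<le> p" "0 < a" "0 \<le> r"
  shows "a powr p + p * a powr (p - 1) * (r - a) \<le> r powr p"
proof (cases "r = 0")
  case True
  then show ?thesis using assms by (simp add: powr_diff)
next
  case False
  have d: "((\<lambda>x. x powr p) has_real_derivative p * a powr (p - 1)) (at a within {0<..})"
    using has_real_derivative_powr[OF assms(2), of p] by (rule has_field_derivative_at_within)
  have "r powr p - a powr p \<ge> (p * a powr (p - 1)) * (r - a)"
    by (rule convex_on_imp_above_tangent[OF powr_convex[OF assms(1)] _ _ _ d])
       (use assms False in \<open>simp_all add: interior_open\<close>)
  then show ?thesis by simp
qed

text \<open>The tangent to the power at the mean \<open>a\<close> lies below it; integrating this
  against the probability density \<open>\<rho>\<close> gives the claim. For \<open>a = 0\<close>
  the left side vanishes.\<close>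

lemma weighted_power_mean:
  fixes g \<rho> :: "'a \<Rightarrow> real"
  assumes "1 \<le> p" "\<And>x. 0 \<le> g x" "\<And>x. 0 \<le> \<rho> x"
    and \<rho>: "integrable M \<rho>" "(\<integral>x. \<rho> x \<partial>M) = 1"
    and g: "integrable M (\<lambda>x. g x * \<rho> x)" and gp: "integrable M (\<lambda>x. g x powr p * \<rho> x)"
  shows "(\<integral>x. g x * \<rho> x \<partial>M) powr p \<le> (\<integral>x. g x powr p * \<rho> x \<partial>M)"
proof -
  define a where "a = (\<integral>x. g x * \<rho> x \<partial>M)"
  have "0 \<le> a" unfolding a_def using assms by simp
  show ?thesis
  proof (cases "a = 0")
    case True
    then show ?thesis using assms by (simp add: a_def)
  next
    case False
    with \<open>0 \<le> a\<close> have a: "0 < a" by simp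
    define K where "K = p * a powr (p - 1)"
    have "a powr p = (\<integral>x. (a powr p - K * a) * \<rho> x + K * (g x * \<rho> x) \<partial>M)"
      using \<rho> g by (simp add: a_def algebra_simps)
    also have "\<dots> \<le> (\<integral>x. g x powr p * \<rho> x \<partial>M)"
    proof (rule integral_mono)
      fix x
      have "(a powr p + K * (g x - a)) * \<rho> x \<le> g x powr p * \<rho> x"
        using powr_above_tangent[OF assms(1) a assms(2)] assms(3) unfolding K_def
        by (intro mult_right_mono) auto
      then show "(a powr p - K * a) * \<rho> x + K * (g x * \<rho> x) \<le> g x powr p * \<rho> x"
        by (simp add: algebra_simps)
    qed (use \<rho> g gp in auto)
    finally show ?thesis unfolding a_def .
  qed
qed

section \<open>Lebesgue spaces on the unit interval\<close>

lemma finite_measure_unit_leb: "finite_measure unit_leb"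
  by (intro finite_measureI) (simp add: emeasure_restrict_space)

lemma Lp_space_finite_iff: "x \<in> Lp_space (ereal p) \<longleftrightarrow>
    x \<in> borel_measurable unit_leb \<and> integrable unit_leb (\<lambda>t. \<bar>x t\<bar> powr p)"
  by (simp add: Lp_space_def)

lemma Lp_space_infinity_iff: "x \<in> Lp_space \<infinity> \<longleftrightarrow>
    x \<in> borel_measurable unit_leb \<and> esssup unit_leb (\<lambda>t. ereal \<bar>x t\<bar>) < \<infinity>"
  by (simp add: Lp_space_def)

text \<open>The unit interval has positive measure, which excludes the value minus infinity. A
  finite essential supremum therefore survives \<open>real_of_ereal\<close> unchanged.\<close>

lemma esssup_abs_nonneg:
  assumes "x \<in> borel_measurable unit_leb"
  shows "0 \<le> esssup unit_leb (\<lambda>t. ereal \<bar>x t\<bar>)"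
proof -
  have "0 = esssup unit_leb (\<lambda>t. 0 :: ereal)"
    by (rule esssup_const[symmetric]) (simp add: emeasure_restrict_space)
  also have "\<dots> \<le> esssup unit_leb (\<lambda>t. ereal \<bar>x t\<bar>)"
    by (rule esssup_mono) auto
  finally show ?thesis .
qed

lemma Lp_norm_infinity_AE:
  assumes "x \<in> Lp_space \<infinity>"
  shows "AE t in unit_leb. \<bar>x t\<bar> \<le> Lp_norm \<infinity> x"
proof -
  have "0 \<le> esssup unit_leb (\<lambda>t. ereal \<bar>x t\<bar>)" "esssup unit_leb (\<lambda>t. ereal \<bar>x t\<bar>) < \<infinity>"
    using assms esssup_abs_nonneg by (auto simp: Lp_space_infinity_iff)
  then have "esssup unit_leb (\<lambda>t. ereal \<bar>x t\<bar>) = ereal (Lp_norm \<infinity> x)"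
    by (cases "esssup unit_leb (\<lambda>t. ereal \<bar>x t\<bar>)") (auto simp: Lp_norm_def)
  then show ?thesis using esssup_AE[where M = unit_leb and f = "\<lambda>t. ereal \<bar>x t\<bar>"] by simp
qed

lemma Lp_space_infinity_bounded:
  assumes x: "x \<in> borel_measurable unit_leb" and C: "AE t in unit_leb. \<bar>x t\<bar> \<le> C"
  shows "x \<in> Lp_space \<infinity>" "Lp_norm \<infinity> x \<le> C"
proof -
  have le: "esssup unit_leb (\<lambda>t. ereal \<bar>x t\<bar>) \<le> ereal C"
    using x C by (intro esssup_I) auto
  show "x \<in> Lp_space \<infinity>" using x le by (auto simp: Lp_space_infinity_iff intro: le_less_trans)
  show "Lp_norm \<infinity> x \<le> C" using le esssup_abs_nonneg[OF x]
    by (cases "esssup unit_leb (\<lambda>t. ereal \<bar>x t\<bar>)") (auto simp: Lp_norm_def)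
qed

lemma integrable_unit_leb_bounded:
  fixes x :: "real \<Rightarrow> real"
  assumes "x \<in> borel_measurable unit_leb" "\<And>t. \<bar>x t\<bar> \<le> C"
  shows "integrable unit_leb x"
  using assms by (intro finite_measure.integrable_const_bound[OF finite_measure_unit_leb, of _ C]) auto

lemma integrable_Lp_space:
  assumes "1 \<le> p" "x \<in> Lp_space (ereal p)"
  shows "integrable unit_leb x"
proof (rule Bochner_Integration.integrable_bound)
  show "integrable unit_leb (\<lambda>t. 1 + \<bar>x t\<bar> powr p)"
    using assms integrable_unit_leb_bounded[of "\<lambda>t. 1" 1] by (auto simp: Lp_space_finite_iff)
  have "\<bar>x t\<bar> \<le> 1 + \<bar>x t\<bar> powr p" for t
  proof (cases "\<bar>x t\<bar> \<le> 1")
    case False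
    then have "\<bar>x t\<bar> powr 1 \<le> \<bar>x t\<bar> powr p" using assms by (intro powr_mono) auto
    then show ?thesis by simp
  next
    case True
    moreover have "0 \<le> \<bar>x t\<bar> powr p" by simp
    ultimately show ?thesis by linarith
  qed
  then show "AE t in unit_leb. norm (x t) \<le> norm (1 + \<bar>x t\<bar> powr p)" by simp
qed (use assms in \<open>auto simp: Lp_space_finite_iff\<close>)

lemma Lp_space_bounded:
  assumes x: "x \<in> borel_measurable unit_leb" and C: "\<And>t. \<bar>x t\<bar> \<le> C" and p: "1 \<le> p"
  shows "x \<in> Lp_space p"
proof (cases p)
  case (real r)
  with p have "\<bar>x t\<bar> powr r \<le> C powr r" for t using C by (intro powr_mono2) auto
  then have "integrable unit_leb (\<lambda>t. \<bar>x t\<bar> powr r)"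
    using x by (intro integrable_unit_leb_bounded[of _ "C powr r"]) auto
  then show ?thesis using x real by (simp add: Lp_space_finite_iff)
next
  case PInf
  then show ?thesis using Lp_space_infinity_bounded(1)[OF x, of C] C by simp
qed (use p in simp)

subsection \<open>A contraction with prescribed image\<close>

text \<open>The case \<open>b \<le> 2 * v\<close> in isolation: \<open>Y\<close> and the labels
  \<open>S\<close> produce the vector \<open>v\<close>, and the operator built here averages over
  \<open>{S = c}\<close> and places the result on \<open>{s = c}\<close>.\<close>

locale step_operator =
  fixes p :: real and q :: ereal and J :: "real set"
    and s S Y :: "real \<Rightarrow> real" and v :: "real \<Rightarrow> real" and R :: real
  assumes p: "1 \<le> p" and pq: "ereal p < q"
    and J: "finite J" "\<And>c. c \<in> J \<Longrightarrow> 0 < c"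
    and meas [measurable]: "s \<in> borel_measurable unit_leb" "S \<in> borel_measurable unit_leb"
      "Y \<in> borel_measurable unit_leb"
    and Y: "\<And>t. 0 \<le> Y t" "\<And>t. Y t \<le> R"
    and v: "\<And>c. c \<in> J \<Longrightarrow> v c = (\<integral>t. (if S t = c then kernel p q (Y t / c) else 0) \<partial>unit_leb)"
    and v_pos: "\<And>c. c \<in> J \<Longrightarrow> 0 < v c"
    and v_ge: "\<And>c. c \<in> J \<Longrightarrow> measure unit_leb {t \<in> {0..1}. s t = c} \<le> 2 * v c"
begin

text \<open>On \<open>{S = c}\<close> the function \<open>h c t * Y t / c\<close> is a probability density. Jensen's inequality for
  this density gives the contraction property, because \<open>kernel z \<le> z\<^sup>p\<close> and \<open>kernel z \<le> z\<^sup>q\<close>.\<close>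

definition h :: "real \<Rightarrow> real \<Rightarrow> real" where
  "h c t = (if S t = c then c / Y t * kernel p q (Y t / c) / v c else 0)"

definition \<phi> :: "real \<Rightarrow> (real \<Rightarrow> real) \<Rightarrow> real" where
  "\<phi> c f = (\<integral>t. f t * h c t \<partial>unit_leb)"

text \<open>The factor 1/2 pays for the 2 in \<open>v_ge\<close>: raised to a power
  \<open>r \<ge> 1\<close> it is at most 1/2.\<close>

definition T :: "(real \<Rightarrow> real) \<Rightarrow> real \<Rightarrow> real" where
  "T f t = (\<Sum>c\<in>J. if s t = c then \<phi> c f / 2 else 0)"

lemma h_measurable [measurable]: "h c \<in> borel_measurable unit_leb"
  unfolding h_def by measurable

lemma h_nonneg: "c \<in> J \<Longrightarrow> 0 \<le> h c t"
  using J(2)[of c] Y(1)[of t] v_pos[of c] kernel_nonneg[of p q "Y t / c"] by (simp add: h_def)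

text \<open>With \<open>z = Y t / c\<close> the factor in question is
  \<open>kernel p q z / z\<close>. By \<open>kernel p q z \<le> z powr p\<close> it is at most 1 for
  \<open>z \<le> 1\<close>, and at most \<open>z powr p \<le> (R / c) powr p\<close> otherwise.
  Boundedness makes \<open>\<phi> c\<close> available on all integrable functions.\<close>

lemma h_bounded:
  assumes c: "c \<in> J"
  shows "\<exists>H. \<forall>t. \<bar>h c t\<bar> \<le> H"
proof -
  have "c / Y t * kernel p q (Y t / c) \<le> 1 + (R / c) powr p" for t
  proof (cases "Y t = 0")
    case False
    with Y have Yt: "0 < Y t" by (simp add: order_less_le)
    have c0: "0 < c" using J c by simp
    define z where "z = Y t / c"
    have z: "0 < z" "z \<le> R / c" using Yt c0 Y by (auto simp: z_def divide_right_mono)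
    have "kernel p q z \<le> z powr p" using z by (intro kernel_le_powr_p pq) auto
    have "kernel p q z / z \<le> 1 + (R / c) powr p"
    proof (cases "z \<le> 1")
      case True
      then have "z powr p \<le> z powr 1" using p z by (intro powr_mono') auto
      then have "kernel p q z / z \<le> 1" using z \<open>kernel p q z \<le> z powr p\<close> by (simp add: divide_le_eq)
      moreover have "0 \<le> (R / c) powr p" by simp
      ultimately show ?thesis by linarith
    next
      case False
      have "kernel p q z / z \<le> kernel p q z / 1"
        using False kernel_nonneg by (intro divide_left_mono) auto
      also have "\<dots> \<le> (R / c) powr p"
        using \<open>kernel p q z \<le> z powr p\<close> z p powr_mono2[of p z "R / c"] by simp
      finally show ?thesis by simp
    qed
    then show ?thesis by (simp add: z_def field_simps)
  qed simp
  then have "c / Y t * kernel p q (Y t / c) / v c \<le> (1 + (R / c) powr p) / v c" for t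
    using v_pos[OF c] by (intro divide_right_mono) auto
  then have "h c t \<le> (1 + (R / c) powr p) / v c" for t
    using v_pos[OF c] by (auto simp: h_def)
  then show ?thesis using h_nonneg[OF c] by auto
qed

lemma integrable_h:
  assumes "c \<in> J" "integrable unit_leb f"
  shows "integrable unit_leb (\<lambda>t. f t * h c t)"
proof -
  obtain H where H: "\<And>t. \<bar>h c t\<bar> \<le> H" using h_bounded[OF assms(1)] by blast
  have [measurable]: "f \<in> borel_measurable unit_leb" using assms by auto
  show ?thesis
  proof (rule Bochner_Integration.integrable_bound)
    show "integrable unit_leb (\<lambda>t. f t * H)" using assms by simp
    have "\<bar>f t\<bar> * \<bar>h c t\<bar> \<le> \<bar>f t\<bar> * \<bar>H\<bar>" for t
      using H[of t] by (intro mult_left_mono) auto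
    then show "AE t in unit_leb. norm (f t * h c t) \<le> norm (f t * H)" by (simp add: abs_mult)
  qed simp
qed

definition \<rho> :: "real \<Rightarrow> real \<Rightarrow> real" where
  "\<rho> c t = (if S t = c then kernel p q (Y t / c) else 0) / v c"

lemma \<rho>_nonneg: "c \<in> J \<Longrightarrow> 0 \<le> \<rho> c t"
  using v_pos[of c] by (auto simp: \<rho>_def kernel_nonneg)

lemma \<rho>_h: "c \<in> J \<Longrightarrow> \<rho> c t = Y t / c * h c t"
  using J(2)[of c] by (cases "Y t = 0") (auto simp: \<rho>_def h_def)

lemma integrable_Y: "integrable unit_leb Y"
  using Y by (intro integrable_unit_leb_bounded[of _ R]) auto

lemma integrable_\<rho>:
  assumes "c \<in> J" shows "integrable unit_leb (\<rho> c)"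
proof -
  have "integrable unit_leb (\<lambda>t. Y t * h c t / c)"
    using integrable_h[OF assms integrable_Y] by simp
  moreover have "\<rho> c = (\<lambda>t. Y t * h c t / c)" using \<rho>_h[OF assms] by auto
  ultimately show ?thesis by simp
qed

lemma integral_\<rho>:
  assumes "c \<in> J" shows "(\<integral>t. \<rho> c t \<partial>unit_leb) = 1"
  using v[OF assms] v_pos[OF assms] unfolding \<rho>_def by simp

lemma \<phi>_Y:
  assumes "c \<in> J" shows "\<phi> c Y = c"
proof -
  have "\<phi> c Y = (\<integral>t. c * \<rho> c t \<partial>unit_leb)"
    unfolding \<phi>_def using \<rho>_h[OF assms] J(2)[OF assms] by (intro Bochner_Integration.integral_cong) auto
  then show ?thesis using integral_\<rho>[OF assms] by simp
qed

lemma T_Y: "T Y t = (if s t \<in> J then s t / 2 else 0)"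
proof -
  have "T Y t = (\<Sum>c\<in>J. if s t = c then s t / 2 else 0)"
    unfolding T_def by (intro sum.cong) (auto simp: \<phi>_Y)
  then show ?thesis using J by simp
qed

text \<open>Jensen's inequality is applied to \<open>g = c * \<bar>f\<bar> / Y\<close> and the
  density \<open>\<rho> c\<close>. The kernel in the density is at most
  \<open>(Y / c) powr r\<close>, which cancels against \<open>g powr r\<close> and leaves
  \<open>\<bar>f\<bar> powr r\<close>.\<close>

lemma \<phi>_power_bound:
  assumes c: "c \<in> J" and r: "1 \<le> r" "\<And>z. 0 \<le> z \<Longrightarrow> kernel p q z \<le> z powr r"
    and f: "f \<in> Lp_space (ereal r)"
  shows "v c * \<bar>\<phi> c f\<bar> powr r \<le> (\<integral>t. (if S t = c then \<bar>f t\<bar> powr r else 0) \<partial>unit_leb)"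
proof -
  have fm [measurable]: "f \<in> borel_measurable unit_leb" and fr: "integrable unit_leb (\<lambda>t. \<bar>f t\<bar> powr r)"
    using f by (auto simp: Lp_space_finite_iff)
  have fi: "integrable unit_leb f" by (rule integrable_Lp_space[OF r(1) f])
  have c0: "0 < c" using J c by simp
  define g where "g t = c * \<bar>f t\<bar> / Y t" for t
  have g: "g t * \<rho> c t = \<bar>f t\<bar> * h c t" for t
    using c0 by (cases "Y t = 0") (auto simp: g_def \<rho>_h[OF c] h_def)
  have ig: "integrable unit_leb (\<lambda>t. g t * \<rho> c t)"
    unfolding g using integrable_h[OF c, of "\<lambda>t. \<bar>f t\<bar>"] fi by simp
  have le: "g t powr r * \<rho> c t \<le> (if S t = c then \<bar>f t\<bar> powr r else 0) / v c" for t
  proof (cases "S t = c \<and> Y t \<noteq> 0")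
    case True
    then have Yt: "0 < Y t" using Y(1)[of t] by simp
    have "kernel p q (Y t / c) \<le> (Y t / c) powr r" using r(2) Yt c0 by simp
    then have "g t powr r * kernel p q (Y t / c) \<le> g t powr r * (Y t / c) powr r"
      by (intro mult_left_mono) auto
    also have "\<dots> = \<bar>f t\<bar> powr r"
      using Yt c0 by (simp add: powr_mult[symmetric] g_def)
    finally show ?thesis using True v_pos[OF c] by (simp add: \<rho>_def divide_right_mono)
  next
    case False
    then have "\<rho> c t = 0" by (auto simp: \<rho>_def)
    then show ?thesis using v_pos[OF c] by simp
  qed
  have ifr: "integrable unit_leb (\<lambda>t. (if S t = c then \<bar>f t\<bar> powr r else 0))"
    by (rule Bochner_Integration.integrable_bound[OF fr]) auto
  have igr: "integrable unit_leb (\<lambda>t. g t powr r * \<rho> c t)"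
  proof (rule Bochner_Integration.integrable_bound)
    show "integrable unit_leb (\<lambda>t. (if S t = c then \<bar>f t\<bar> powr r else 0) / v c)" using ifr by simp
    show "(\<lambda>t. g t powr r * \<rho> c t) \<in> borel_measurable unit_leb"
      unfolding g_def \<rho>_def by measurable
    have "0 \<le> g t powr r * \<rho> c t" for t using \<rho>_nonneg[OF c] by simp
    then show "AE t in unit_leb. norm (g t powr r * \<rho> c t) \<le> norm ((if S t = c then \<bar>f t\<bar> powr r else 0) / v c)"
      using le by (intro AE_I2) (smt (verit) real_norm_def)
  qed
  have "\<bar>\<phi> c f\<bar> \<le> (\<integral>t. \<bar>f t * h c t\<bar> \<partial>unit_leb)"
    unfolding \<phi>_def by (rule integral_abs_bound)
  also have "\<dots> = (\<integral>t. g t * \<rho> c t \<partial>unit_leb)"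
    using h_nonneg[OF c] by (simp add: g abs_mult)
  finally have "\<bar>\<phi> c f\<bar> powr r \<le> (\<integral>t. g t * \<rho> c t \<partial>unit_leb) powr r"
    using r by (intro powr_mono2) auto
  also have "\<dots> \<le> (\<integral>t. g t powr r * \<rho> c t \<partial>unit_leb)"
    using r c0 Y ig igr by (intro weighted_power_mean integrable_\<rho> integral_\<rho> c \<rho>_nonneg)
      (auto simp: g_def)
  also have "\<dots> \<le> (\<integral>t. (if S t = c then \<bar>f t\<bar> powr r else 0) / v c \<partial>unit_leb)"
    using ifr igr le by (intro integral_mono) auto
  also have "\<dots> = (\<integral>t. (if S t = c then \<bar>f t\<bar> powr r else 0) \<partial>unit_leb) / v c" by simp
  finally show ?thesis using v_pos[OF c] by (simp add: field_simps)
qed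

lemma T_measurable [measurable]: "T f \<in> borel_measurable unit_leb"
  unfolding T_def by measurable

lemma T_bounded: "\<bar>T f t\<bar> \<le> (\<Sum>c\<in>J. \<bar>\<phi> c f\<bar>)"
  unfolding T_def by (rule order_trans[OF sum_abs]) (intro sum_mono, auto)

lemma T_eq: "T f t = (if s t \<in> J then \<phi> (s t) f / 2 else 0)"
  unfolding T_def using J by simp

text \<open>The sets \<open>{s = c}\<close> are disjoint, so the integral for \<open>T f\<close>
  splits into one term for each \<open>c\<close>. Each term is controlled by the integral of
  \<open>\<bar>f\<bar> powr r\<close> over \<open>{S = c}\<close>, and these sets are disjoint
  too.\<close>

lemma Lp_norm_T_finite:
  assumes r: "1 \<le> r" "\<And>z. 0 \<le> z \<Longrightarrow> kernel p q z \<le> z powr r" and f: "f \<in> Lp_space (ereal r)"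
  shows "Lp_norm (ereal r) (T f) \<le> Lp_norm (ereal r) f"
proof -
  interpret finite_measure unit_leb by (rule finite_measure_unit_leb)
  have fm [measurable]: "f \<in> borel_measurable unit_leb" and fr: "integrable unit_leb (\<lambda>t. \<bar>f t\<bar> powr r)"
    using f by (auto simp: Lp_space_finite_iff)
  have ifr: "integrable unit_leb (\<lambda>t. (if S t = c then \<bar>f t\<bar> powr r else 0))" for c
    by (rule Bochner_Integration.integrable_bound[OF fr]) auto
  have sets: "{t \<in> {0..1}. s t = c} \<in> sets unit_leb" for c
    using measurable_sets[OF meas(1), of "{c}"] by (simp add: vimage_def Int_def conj_commute)
  have "(\<integral>t. \<bar>T f t\<bar> powr r \<partial>unit_leb)
      = (\<integral>t. (\<Sum>c\<in>J. indicator {t \<in> {0..1}. s t = c} t * \<bar>\<phi> c f / 2\<bar> powr r) \<partial>unit_leb)"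
  proof (rule Bochner_Integration.integral_cong)
    fix t assume "t \<in> space unit_leb"
    then have t: "t \<in> {0..1}" by simp
    have "(\<Sum>c\<in>J. indicator {t \<in> {0..1}. s t = c} t * \<bar>\<phi> c f / 2\<bar> powr r)
       = (\<Sum>c\<in>J. if s t = c then \<bar>\<phi> (s t) f / 2\<bar> powr r else 0)"
      using t by (intro sum.cong) auto
    then show "\<bar>T f t\<bar> powr r = (\<Sum>c\<in>J. indicator {t \<in> {0..1}. s t = c} t * \<bar>\<phi> c f / 2\<bar> powr r)"
      using J by (simp add: T_eq)
  qed simp
  also have "\<dots> = (\<Sum>c\<in>J. measure unit_leb {t \<in> {0..1}. s t = c} * \<bar>\<phi> c f / 2\<bar> powr r)"
  proof (subst Bochner_Integration.integral_sum)
    have "{t \<in> {0..1}. s t = c} \<inter> space unit_leb = {t \<in> {0..1}. s t = c}" for c by auto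
    then show "(\<Sum>c\<in>J. \<integral>t. indicator {t \<in> {0..1}. s t = c} t * \<bar>\<phi> c f / 2\<bar> powr r \<partial>unit_leb)
        = (\<Sum>c\<in>J. measure unit_leb {t \<in> {0..1}. s t = c} * \<bar>\<phi> c f / 2\<bar> powr r)"
      by (simp only: integral_mult_left_zero Bochner_Integration.integral_indicator)
    show "integrable unit_leb (\<lambda>t. indicator {t \<in> {0..1}. s t = c} t * \<bar>\<phi> c f / 2\<bar> powr r)" for c
      by (intro Bochner_Integration.integrable_mult_left integrable_real_indicator sets)
        (simp add: less_top[symmetric])
  qed
  also have "\<dots> \<le> (\<Sum>c\<in>J. \<integral>t. (if S t = c then \<bar>f t\<bar> powr r else 0) \<partial>unit_leb)"
  proof (rule sum_mono)
    fix c assume c: "c \<in> J"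
    have "2 powr 1 \<le> (2::real) powr r" using r by (intro powr_mono) auto
    then have "\<bar>\<phi> c f\<bar> powr r / 2 powr r \<le> \<bar>\<phi> c f\<bar> powr r / 2"
      by (intro divide_left_mono) auto
    then have "measure unit_leb {t \<in> {0..1}. s t = c} * \<bar>\<phi> c f / 2\<bar> powr r
        \<le> (2 * v c) * (\<bar>\<phi> c f\<bar> powr r / 2)"
      using v_ge[OF c] v_pos[OF c] by (intro mult_mono) (auto simp: powr_divide)
    also have "\<dots> \<le> (\<integral>t. (if S t = c then \<bar>f t\<bar> powr r else 0) \<partial>unit_leb)"
      using \<phi>_power_bound[OF c r f] by simp
    finally show "measure unit_leb {t \<in> {0..1}. s t = c} * \<bar>\<phi> c f / 2\<bar> powr r
      \<le> (\<integral>t. (if S t = c then \<bar>f t\<bar> powr r else 0) \<partial>unit_leb)" .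
  qed
  also have "\<dots> = (\<integral>t. (\<Sum>c\<in>J. if S t = c then \<bar>f t\<bar> powr r else 0) \<partial>unit_leb)"
    using ifr by (subst Bochner_Integration.integral_sum) auto
  also have "\<dots> \<le> (\<integral>t. \<bar>f t\<bar> powr r \<partial>unit_leb)"
    using J ifr fr by (intro integral_mono Bochner_Integration.integrable_sum) auto
  finally show ?thesis using r by (auto simp: Lp_norm_def intro!: powr_mono2)
qed

text \<open>For \<open>q = \<infinity>\<close> the kernel vanishes where \<open>Y t < c\<close>.
  Where it does not vanish, \<open>c / Y t \<le> 1\<close>, so \<open>h c \<le> \<rho> c\<close> and
  \<open>\<phi> c f\<close> is bounded by a mean of \<open>\<bar>f\<bar>\<close>.\<close>

lemma Lp_norm_T_infinity:
  assumes q: "q = \<infinity>" and f: "f \<in> Lp_space \<infinity>" "integrable unit_leb f"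
  shows "Lp_norm \<infinity> (T f) \<le> Lp_norm \<infinity> f"
proof (rule Lp_space_infinity_bounded)
  define C where "C = Lp_norm \<infinity> f"
  have C: "AE t in unit_leb. \<bar>f t\<bar> \<le> C" unfolding C_def by (rule Lp_norm_infinity_AE[OF f(1)])
  have fm [measurable]: "f \<in> borel_measurable unit_leb" using f by auto
  have C0: "0 \<le> C" using esssup_abs_nonneg[OF fm] by (simp add: C_def Lp_norm_def real_of_ereal_pos)
  have "\<bar>\<phi> c f\<bar> \<le> C" if c: "c \<in> J" for c
  proof -
    have c0: "0 < c" using J c by simp
    have hr: "h c t \<le> \<rho> c t" for t
    proof (cases "S t = c \<and> c \<le> Y t")
      case True
      then have "c / Y t \<le> 1" using c0 by simp
      then have "c / Y t * kernel p q (Y t / c) \<le> 1 * kernel p q (Y t / c)"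
        by (intro mult_right_mono kernel_nonneg)
      then have "c / Y t * kernel p q (Y t / c) / v c \<le> 1 * kernel p q (Y t / c) / v c"
        using v_pos[OF c] by (intro divide_right_mono) auto
      then show ?thesis using True unfolding h_def \<rho>_def by simp
    next
      case False
      then have "h c t = 0" unfolding h_def using c0 by (auto simp: kernel_def q)
      then show ?thesis using \<rho>_nonneg[OF c] by simp
    qed
    have "\<bar>\<phi> c f\<bar> \<le> (\<integral>t. \<bar>f t * h c t\<bar> \<partial>unit_leb)"
      unfolding \<phi>_def by (rule integral_abs_bound)
    also have "\<dots> \<le> (\<integral>t. C * \<rho> c t \<partial>unit_leb)"
    proof (rule integral_mono_AE)
      show "AE t in unit_leb. \<bar>f t * h c t\<bar> \<le> C * \<rho> c t"
        using C
      proof eventually_elim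
        case (elim t)
        then show ?case using hr h_nonneg[OF c] C0 by (auto simp: abs_mult intro!: mult_mono)
      qed
    qed (use integrable_h[OF c f(2)] integrable_\<rho>[OF c] in auto)
    also have "\<dots> = C" using integral_\<rho>[OF c] by simp
    finally show ?thesis .
  qed
  then have "\<bar>T f t\<bar> \<le> C" for t using C0 by (fastforce simp: T_eq)
  then show "AE t in unit_leb. \<bar>T f t\<bar> \<le> Lp_norm \<infinity> f" unfolding C_def by simp
qed simp

lemma linear_contraction_T: "linear_contraction p q T"
proof -
  have q1: "1 \<le> q" using p pq by (metis ereal_less_eq(3) less_imp_le one_ereal_def order_trans)
  have T_in: "T f \<in> Lp_space (ereal p) \<inter> Lp_space q" for f
    using Lp_space_bounded[OF T_measurable T_bounded] p q1 by auto
  have fi: "integrable unit_leb f" if "f \<in> Lp_space (ereal p)" for f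
    using integrable_Lp_space[OF p that] .
  have "T (\<lambda>s. x s + y s) t = T x t + T y t"
    if "x \<in> Lp_space (ereal p)" "y \<in> Lp_space (ereal p)" for x y t
    using fi[OF that(1)] fi[OF that(2)] integrable_h
    by (auto simp: T_eq \<phi>_def distrib_right add_divide_distrib)
  moreover have "T (\<lambda>s. a * x s) t = a * T x t" for a x t
    by (auto simp: T_eq \<phi>_def mult.assoc)
  moreover have "Lp_norm p (T x) \<le> Lp_norm p x" if "x \<in> Lp_space (ereal p)" for x
    by (rule Lp_norm_T_finite[OF p kernel_le_powr_p[OF pq] that])
  moreover have "Lp_norm q (T x) \<le> Lp_norm q x" if x: "x \<in> Lp_space (ereal p)" "x \<in> Lp_space q" for x
  proof (cases "q = \<infinity>")
    case True
    then show ?thesis using Lp_norm_T_infinity fi x by simp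
  next
    case False
    then obtain r where r: "q = ereal r" using q1 by (cases q) auto
    have "1 \<le> r" using q1 r by simp
    then show ?thesis using Lp_norm_T_finite[of r x] kernel_le_powr_q[OF pq False] x r by simp
  qed
  ultimately show ?thesis unfolding linear_contraction_def Let_def using T_in by auto
qed

end

subsection \<open>Dilated sums and rearrangement invariant spaces\<close>

text \<open>The dilated sum without absolute values, so that it can also transport label functions
  and integrands.\<close>

definition dil :: "nat \<Rightarrow> (nat \<Rightarrow> real \<Rightarrow> real) \<Rightarrow> real \<Rightarrow> real" where
  "dil n F t = (\<Sum>k=1..n. indicator {(real k - 1) / real n <..< real k / real n} t
     * F k (real n * t - real k + 1))"

lemma dilated_sum_eq_dil: "dilated_sum n x = dil n (\<lambda>k t. \<bar>x k t\<bar>)"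
  by (simp add: dilated_sum_def dil_def fun_eq_iff)

text \<open>The piece containing \<open>t\<close> is chosen before the family \<open>F\<close>, so
  several families can be evaluated at \<open>t\<close> simultaneously.\<close>

lemma dil_cases:
  obtains (inside) k where "k \<in> {1..n}" "\<And>F. dil n F t = F k (real n * t - real k + 1)"
  | (outside) "\<And>F. dil n F t = 0"
proof (cases "\<exists>k\<in>{1..n}. t \<in> {(real k - 1) / real n <..< real k / real n}")
  case False
  then have "dil n F t = 0" for F unfolding dil_def by (intro sum.neutral) auto
  then show thesis by (rule outside)
next
  case True
  then obtain k where k: "k \<in> {1..n}" "t \<in> {(real k - 1) / real n <..< real k / real n}" by blast
  have "dil n F t = (\<Sum>j=1..n. if j = k then F k (real n * t - real k + 1) else 0)" for F
    unfolding dil_def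
  proof (intro sum.cong refl)
    fix j assume j: "j \<in> {1..n}"
    have "j = k" if "t \<in> {(real j - 1) / real n <..< real j / real n}"
    proof -
      have n: "0 < real n" using k by simp
      have "real j - 1 < real n * t" "real n * t < real j" "real k - 1 < real n * t" "real n * t < real k"
        using that k n by (auto simp: field_simps)
      then have "real j < real (Suc k)" "real k < real (Suc j)" by auto
      then show ?thesis by linarith
    qed
    then show "indicator {(real j - 1) / real n <..< real j / real n} t * F j (real n * t - real j + 1)
        = (if j = k then F k (real n * t - real k + 1) else 0)"
      using k by (cases "j = k") (auto simp: indicator_def)
  qed
  then have "dil n F t = F k (real n * t - real k + 1)" for F using k by simp
  then show thesis using inside k by blast
qed

text \<open>Inside a piece both sides evaluate the same functions at the same point;
  \<open>g 0 0 = 0\<close> covers the break points and the outside, where dilated sums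
  vanish.\<close>

lemma dil_map2:
  assumes "g 0 0 = (0::real)"
  shows "dil n (\<lambda>k t. g (F k t) (G k t)) t = g (dil n F t) (dil n G t)"
  by (rule dil_cases[of n t]) (simp_all add: assms)

text \<open>An affine change of variables shows that each piece carries \<open>1 / n\<close> of the
  integral of its function.\<close>

lemma integral_dil:
  fixes F :: "nat \<Rightarrow> real \<Rightarrow> real"
  assumes n: "1 \<le> n" and F: "\<And>k. k \<in> {1..n} \<Longrightarrow> integrable unit_leb (F k)"
  shows "(\<integral>t. dil n F t \<partial>unit_leb) = (\<Sum>k=1..n. \<integral>t. F k t \<partial>unit_leb) / real n"
proof -
  \<comment> \<open>The cutoff to the open interval matches the open pieces exactly and differs from
    that to \<open>{0..1}\<close> only on a null set.\<close>
  define H where "H k t = indicator {0<..<1::real} t * F k t" for k t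
  have piece: "indicator {0..1} t * (indicator {(real k - 1) / real n <..< real k / real n} t
     * F k (real n * t - real k + 1)) = H k ((1 - real k) + real n * t)" if k: "k \<in> {1..n}" for k t
  proof -
    have n0: "0 < real n" using n by simp
    have "t \<in> {(real k - 1) / real n <..< real k / real n} \<longleftrightarrow> (1 - real k) + real n * t \<in> {0<..<1}"
      using n0 by (auto simp: field_simps)
    moreover have "t \<in> {0..1}" if "t \<in> {(real k - 1) / real n <..< real k / real n}"
    proof -
      have "0 \<le> (real k - 1) / real n" "real k / real n \<le> 1" using k n0 by auto
      then show ?thesis using that by auto
    qed
    ultimately show ?thesis by (auto simp: H_def indicator_def algebra_simps)
  qed
  have ae: "AE t in lebesgue. indicator {0..1} t * F k t = H k t" for k
  proof -
    have "{0, 1::real} \<in> null_sets lebesgue" by (simp add: negligible_iff_null_sets[symmetric])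
    from AE_not_in[OF this] show ?thesis by eventually_elim (auto simp: H_def indicator_def)
  qed
  have iF: "integrable lebesgue (\<lambda>t. indicator {0..1} t * F k t)" if "k \<in> {1..n}" for k
    using F[OF that] by (simp add: integrable_restrict_space)
  have Hm: "H k \<in> borel_measurable lebesgue" if "k \<in> {1..n}" for k
  proof -
    have "(\<lambda>t. indicator {0<..<1} t * (indicator {0..1} t * F k t)) \<in> borel_measurable lebesgue"
      by (rule borel_measurable_times[OF borel_measurable_indicator borel_measurable_integrable[OF iF[OF that]]])
        simp
    also have "(\<lambda>t. indicator {0<..<1} t * (indicator {0..1} t * F k t)) = H k"
      by (auto simp: H_def indicator_def)
    finally show ?thesis .
  qed
  have iH: "integrable lebesgue (H k)" if "k \<in> {1..n}" for k
    using integrable_cong_AE_imp[OF iF[OF that] Hm[OF that]] ae[of k] by (auto simp: eq_commute)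
  have vH: "(\<integral>t. H k t \<partial>lebesgue) = (\<integral>t. F k t \<partial>unit_leb)" if "k \<in> {1..n}" for k
  proof -
    have "(\<integral>t. F k t \<partial>unit_leb) = (\<integral>t. indicator {0..1} t * F k t \<partial>lebesgue)"
      by (simp add: integral_restrict_space)
    also have "\<dots> = (\<integral>t. H k t \<partial>lebesgue)"
      using iF[OF that] Hm[OF that] ae by (intro integral_cong_AE) auto
    finally show ?thesis by simp
  qed
  have "(\<integral>t. dil n F t \<partial>unit_leb) = (\<integral>t. indicator {0..1} t * dil n F t \<partial>lebesgue)"
    by (simp add: integral_restrict_space)
  also have "\<dots> = (\<integral>t. (\<Sum>k=1..n. H k ((1 - real k) + real n * t)) \<partial>lebesgue)"
    unfolding dil_def sum_distrib_left using piece by (intro Bochner_Integration.integral_cong sum.cong) auto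
  also have "\<dots> = (\<Sum>k=1..n. \<integral>t. H k ((1 - real k) + real n * t) \<partial>lebesgue)"
    using iH n by (intro Bochner_Integration.integral_sum)
      (simp add: lebesgue_integrable_real_affine_iff[of "real n" "H _"])
  also have "\<dots> = (\<Sum>k=1..n. (\<integral>t. F k t \<partial>unit_leb) / real n)"
  proof (rule sum.cong)
    fix k assume k: "k \<in> {1..n}"
    have "(\<integral>t. H k t \<partial>lebesgue) = real n * (\<integral>t. H k ((1 - real k) + real n * t) \<partial>lebesgue)"
      using lebesgue_integral_real_affine[of "real n" "H k" "1 - real k"] n by simp
    then show "(\<integral>t. H k ((1 - real k) + real n * t) \<partial>lebesgue) = (\<integral>t. F k t \<partial>unit_leb) / real n"
      using vH[OF k] n by (simp add: field_simps)
  qed simp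
  finally show ?thesis by (simp add: sum_divide_distrib)
qed

lemma measurable_dil:
  fixes F :: "nat \<Rightarrow> real \<Rightarrow> real"
  assumes n: "1 \<le> n" and F: "\<And>k. k \<in> {1..n} \<Longrightarrow> F k \<in> borel_measurable unit_leb"
  shows "dil n F \<in> borel_measurable unit_leb"
proof -
  have "(\<lambda>t. indicator {(real k - 1) / real n <..< real k / real n} t
     * F k (real n * t - real k + 1)) \<in> borel_measurable unit_leb" if k: "k \<in> {1..n}" for k
  proof -
    \<comment> \<open>Measurability of \<open>F k\<close> is known on \<open>{0..1}\<close> alone,
      so it is extended by 0 before composing with the affine map of the line.\<close>
    define G where "G t = (if t \<in> {0..1} then F k t else 0)" for t
    have "G \<in> borel_measurable lebesgue"
      using F[OF k] unfolding G_def by (subst borel_measurable_if) auto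
    moreover have "(\<lambda>t. (1 - real k) + real n * t) \<in> lebesgue \<rightarrow>\<^sub>M lebesgue"
      using lebesgue_affine_measurable[where c = "\<lambda>x::real. real n" and t = "1 - real k"] n by simp
    ultimately have Gm: "(\<lambda>t. G ((1 - real k) + real n * t)) \<in> borel_measurable lebesgue"
      by (rule measurable_compose[rotated])
    have "(\<lambda>t. indicator {(real k - 1) / real n <..< real k / real n} t * G ((1 - real k) + real n * t))
       \<in> borel_measurable lebesgue"
      by (intro borel_measurable_times borel_measurable_indicator Gm) simp
    also have "(\<lambda>t. indicator {(real k - 1) / real n <..< real k / real n} t * G ((1 - real k) + real n * t))
       = (\<lambda>t. indicator {(real k - 1) / real n <..< real k / real n} t * F k (real n * t - real k + 1))"
    proof
      fix t
      have "(1 - real k) + real n * t \<in> {0..1}" if "t \<in> {(real k - 1) / real n <..< real k / real n}"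
        using that n by (auto simp: field_simps)
      then show "indicator {(real k - 1) / real n <..< real k / real n} t * G ((1 - real k) + real n * t)
       = indicator {(real k - 1) / real n <..< real k / real n} t * F k (real n * t - real k + 1)"
        by (auto simp: G_def indicator_def algebra_simps)
    qed
    finally show ?thesis by (rule measurable_restrict_space1)
  qed
  then show ?thesis unfolding dil_def by (intro borel_measurable_sum)
qed

section \<open>Lattice and Fatou properties of the norm\<close>

context ri_space
begin

lemma lattice_mono:
  assumes y: "y \<in> E" and x [measurable]: "x \<in> borel_measurable unit_leb"
    and le: "AE t in unit_leb. \<bar>x t\<bar> \<le> \<bar>y t\<bar>"
  shows "x \<in> E" "N x \<le> N y"
proof -
  interpret finite_measure unit_leb by (rule finite_measure_unit_leb)
  have ym [measurable]: "y \<in> borel_measurable unit_leb" using y by (rule measurable)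
  have sets: "{t \<in> {0..1}. \<bar>z t\<bar> > l} \<in> sets unit_leb" if z: "z \<in> borel_measurable unit_leb" for z and l :: real
  proof -
    have "{t \<in> space unit_leb. \<bar>z t\<bar> > l} \<in> sets unit_leb" using z by measurable
    then show ?thesis by simp
  qed
  have mle: "measure unit_leb {t \<in> {0..1}. \<bar>x t\<bar> > l} \<le> measure unit_leb {t \<in> {0..1}. \<bar>y t\<bar> > l}" for l
    using le sets[OF x] sets[OF ym] by (intro finite_measure_mono_AE) auto
  \<comment> \<open>Vanishing tails make the set in \<open>decr_rearr y s\<close> nonempty for
    \<open>s > 0\<close>, so that the two infima can be compared by inclusion.\<close>
  have lim: "(\<lambda>i. measure unit_leb {t \<in> {0..1}. \<bar>y t\<bar> > real i}) \<longlonglongrightarrow> 0"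
  proof -
    have "(\<lambda>i. measure unit_leb {t \<in> {0..1}. \<bar>y t\<bar> > real i})
      \<longlonglongrightarrow> measure unit_leb (\<Inter>i. {t \<in> {0..1}. \<bar>y t\<bar> > real i})"
      using sets[OF ym] by (intro finite_Lim_measure_decseq) (auto simp: decseq_def)
    moreover have "(\<Inter>i. {t \<in> {0..1}. \<bar>y t\<bar> > real i}) = {}"
    proof -
      have "\<exists>i. \<bar>y t\<bar> \<le> real i" for t using real_arch_simple by blast
      then show ?thesis by (auto, meson not_le)
    qed
    ultimately show ?thesis by simp
  qed
  have "decr_rearr x s \<le> decr_rearr y s" if s: "0 < s" for s
  proof -
    obtain i where "measure unit_leb {t \<in> {0..1}. \<bar>y t\<bar> > real i} < s"
      using order_tendstoD(2)[OF lim s] by (auto dest: eventually_happens)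
    then have "real i \<in> {l. 0 \<le> l \<and> measure unit_leb {t \<in> {0..1}. \<bar>y t\<bar> > l} \<le> s}" by simp
    then have ne: "{l. 0 \<le> l \<and> measure unit_leb {t \<in> {0..1}. \<bar>y t\<bar> > l} \<le> s} \<noteq> {}" by blast
    show ?thesis unfolding decr_rearr_def
      using mle by (intro cInf_superset_mono ne) (auto intro: order_trans bdd_belowI[of _ 0])
  qed
  then have "x \<in> E \<and> N x \<le> N y" using rearrangement_invariant[OF y x] by blast
  then show "x \<in> E" "N x \<le> N y" by auto
qed

text \<open>Maximal and minimal spaces both lie in the bidual and carry its norm. On the bidual the
  extended norm is finite, so \<open>enn2real\<close> can be undone.\<close>

lemma norm_eq_kothe_binorm:
  assumes "maximal_space E N \<or> minimal_space E N" "x \<in> E"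
  shows "ennreal (N x) = (SUP g\<in>{g\<in>kothe_dual E N. kothe_norm E N g \<le> 1}.
    \<integral>\<^sup>+ t. ennreal \<bar>g t * x t\<bar> \<partial>unit_leb)"
proof -
  have "x \<in> kothe_bidual E N" "N x = kothe_binorm E N x"
    using assms by (auto simp: maximal_space_def minimal_space_def)
  then have "ennreal (N x) = kothe_enorm (kothe_dual E N) (kothe_norm E N) x"
    by (auto simp: kothe_bidual_def kothe_binorm_def kothe_dual_def[of "kothe_dual E N"]
        kothe_norm_def[of "kothe_dual E N"])
  then show ?thesis by (simp add: kothe_enorm_def)
qed

text \<open>Some \<open>g\<close> in the dual unit ball pairs with \<open>u\<close> to more than
  \<open>a\<close>; by monotone convergence it does so with some \<open>U i\<close>.\<close>

lemma fatou_norm: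
  assumes mm: "maximal_space E N \<or> minimal_space E N"
    and u: "u \<in> E" and U: "\<And>i. U i \<in> E" "\<And>i t. 0 \<le> U i t" "\<And>t. incseq (\<lambda>i. U i t)"
    and lim: "\<And>t. (\<lambda>i. U i t) \<longlonglongrightarrow> u t" and a: "0 \<le> a" "a < N u"
  shows "\<exists>i. a < N (U i)"
proof -
  have "ennreal a < ennreal (N u)" using a by (simp add: ennreal_lessI)
  then obtain g where g: "g \<in> kothe_dual E N" "kothe_norm E N g \<le> 1"
    and ag: "ennreal a < (\<integral>\<^sup>+ t. ennreal \<bar>g t * u t\<bar> \<partial>unit_leb)"
    unfolding norm_eq_kothe_binorm[OF mm u] less_SUP_iff by auto
  have gm [measurable]: "g \<in> borel_measurable unit_leb" using g by (simp add: kothe_dual_def)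
  have Um [measurable]: "U i \<in> borel_measurable unit_leb" for i using U(1) by (rule measurable)
  have "(\<lambda>i. \<integral>\<^sup>+ t. ennreal \<bar>g t * U i t\<bar> \<partial>unit_leb) \<longlonglongrightarrow> (\<integral>\<^sup>+ t. ennreal \<bar>g t * u t\<bar> \<partial>unit_leb)"
  proof (rule nn_integral_LIMSEQ)
    show "incseq (\<lambda>i t. ennreal \<bar>g t * U i t\<bar>)"
      using U(2,3) by (auto simp: incseq_def le_fun_def abs_mult intro!: ennreal_leI mult_left_mono)
    show "(\<lambda>i. ennreal \<bar>g t * U i t\<bar>) \<longlonglongrightarrow> ennreal \<bar>g t * u t\<bar>" for t
      by (intro tendsto_ennrealI tendsto_intros lim)
  qed simp
  from order_tendstoD(1)[OF this ag]
  obtain i where "ennreal a < (\<integral>\<^sup>+ t. ennreal \<bar>g t * U i t\<bar> \<partial>unit_leb)"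
    by (auto simp: eventually_sequentially)
  also have "\<dots> \<le> ennreal (N (U i))"
    unfolding norm_eq_kothe_binorm[OF mm U(1)] using g by (intro SUP_upper) auto
  finally show ?thesis using a by (auto simp: ennreal_less_iff)
qed

end

subsection \<open>Maxima of kernels\<close>

text \<open>The extra 0 covers empty \<open>J\<close> and changes nothing for nonempty
  \<open>J\<close> and nonnegative weights.\<close>

definition kernel_max :: "real \<Rightarrow> ereal \<Rightarrow> real set \<Rightarrow> (real \<Rightarrow> real) \<Rightarrow> real \<Rightarrow> real" where
  "kernel_max p q J w s = Max (insert 0 ((\<lambda>c. w c * kernel p q (s / c)) ` J))"

lemma kernel_max_nonneg: "finite J \<Longrightarrow> 0 \<le> kernel_max p q J w s"
  unfolding kernel_max_def by (intro Max_ge) auto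

lemma kernel_max_ge: "finite J \<Longrightarrow> c \<in> J \<Longrightarrow> w c * kernel p q (s / c) \<le> kernel_max p q J w s"
  unfolding kernel_max_def by (intro Max_ge) auto

lemma kernel_max_le:
  assumes "finite J" "0 \<le> a" "\<And>c. c \<in> J \<Longrightarrow> w c * kernel p q (s / c) \<le> a"
  shows "kernel_max p q J w s \<le> a"
  using assms unfolding kernel_max_def by (subst Max_le_iff) auto

lemma kernel_max_0: "finite J \<Longrightarrow> kernel_max p q J w 0 = 0"
  by (intro antisym kernel_max_le kernel_max_nonneg) auto

text \<open>Induction on \<open>J\<close> gives a Borel choice of a maximising label: the new label
  is taken where its term is strictly larger. Since labels are positive, 0 can stand for no
  choice.\<close>

lemma kernel_max_selection:
  assumes "finite J" "\<And>c. c \<in> J \<Longrightarrow> 0 < c"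
  shows "\<exists>\<sigma>\<in>borel_measurable borel. \<forall>s. kernel_max p q J w s
    = (\<Sum>c\<in>J. w c * (if \<sigma> s = c then kernel p q (s / c) else 0))"
  using assms
proof (induction J)
  case empty
  show ?case by (intro bexI[of _ "\<lambda>s. 0"]) (auto simp: kernel_max_def)
next
  case (insert c J)
  then obtain \<sigma> where [measurable]: "\<sigma> \<in> borel_measurable borel"
    and \<sigma>: "\<And>s. kernel_max p q J w s = (\<Sum>c\<in>J. w c * (if \<sigma> s = c then kernel p q (s / c) else 0))" by blast
  define m where "m s = (\<Sum>c\<in>J. w c * (if \<sigma> s = c then kernel p q (s / c) else 0))" for s
  have [measurable]: "m \<in> borel_measurable borel" unfolding m_def by measurable
  have b: "0 \<notin> insert c J" using insert(4) by blast
  \<comment> \<open>The old \<open>\<sigma>\<close> may happen to take the new value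
    \<open>c\<close>; relabelling by 0 keeps the new term from being counted there.\<close>
  define \<tau> where "\<tau> s = (if m s < w c * kernel p q (s / c) then c else if \<sigma> s = c then 0 else \<sigma> s)" for s
  have "\<tau> \<in> borel_measurable borel" unfolding \<tau>_def by measurable
  moreover have "kernel_max p q (insert c J) w s
      = (\<Sum>d\<in>insert c J. w d * (if \<tau> s = d then kernel p q (s / d) else 0))" for s
  proof -
    have "insert 0 ((\<lambda>c. w c * kernel p q (s / c)) ` insert c J)
        = insert (w c * kernel p q (s / c)) (insert 0 ((\<lambda>c. w c * kernel p q (s / c)) ` J))" by auto
    then have "kernel_max p q (insert c J) w s = max (w c * kernel p q (s / c)) (m s)"
      unfolding m_def \<sigma>[symmetric] kernel_max_def using insert(1)
      by (simp only: Max_insert finite_insert finite_imageI) simp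
    moreover have "(\<Sum>d\<in>J. w d * (if \<tau> s = d then kernel p q (s / d) else 0))
        = (if m s < w c * kernel p q (s / c) then 0 else m s)"
    proof (cases "m s < w c * kernel p q (s / c)")
      case True
      then have "\<tau> s \<notin> J" using insert(2) by (simp add: \<tau>_def)
      then show ?thesis using True by (auto intro!: sum.neutral)
    next
      case False
      then have "\<tau> s = d \<longleftrightarrow> \<sigma> s = d" if "d \<in> J" for d
        using that insert(2) b by (auto simp: \<tau>_def)
      then show ?thesis using False by (auto simp: m_def intro!: sum.cong)
    qed
    ultimately show ?thesis using insert(1,2) b by (auto simp: \<tau>_def)
  qed
  ultimately show ?case by blast
qed

lemma kernel_max_growth_p:
  assumes J: "finite J" "\<And>c. c \<in> J \<Longrightarrow> 0 < c" and w: "\<And>c. 0 \<le> w c"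
    and pq: "ereal p < q" and st: "0 < s" "s \<le> t"
  shows "kernel_max p q J w s * t powr p \<le> kernel_max p q J w t * s powr p"
proof -
  define a where "a = kernel_max p q J w t * s powr p / t powr p"
  have "kernel_max p q J w s \<le> a"
  proof (rule kernel_max_le[OF J(1)])
    show "0 \<le> a" using kernel_max_nonneg[OF J(1)] by (simp add: a_def)
    fix c assume c: "c \<in> J"
    have c0: "0 < c" using J c by simp
    have "kernel p q (s / c) * (t / c) powr p \<le> kernel p q (t / c) * (s / c) powr p"
      using st c0 by (intro kernel_growth_p pq) (auto simp: divide_right_mono)
    then have "kernel p q (s / c) * t powr p \<le> kernel p q (t / c) * s powr p"
      using st c0 by (simp add: powr_divide divide_right_mono_neg field_simps)
    then have "w c * (kernel p q (s / c) * t powr p) \<le> w c * (kernel p q (t / c) * s powr p)"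
      using w by (rule mult_left_mono)
    also have "\<dots> = (w c * kernel p q (t / c)) * s powr p" by simp
    also have "\<dots> \<le> kernel_max p q J w t * s powr p"
      by (intro mult_right_mono kernel_max_ge J c) simp
    finally show "w c * kernel p q (s / c) \<le> a" using st by (simp add: a_def field_simps)
  qed
  then show ?thesis using st by (simp add: a_def field_simps)
qed

lemma kernel_max_growth_q:
  assumes J: "finite J" "\<And>c. c \<in> J \<Longrightarrow> 0 < c" and w: "\<And>c. 0 \<le> w c"
    and pq: "ereal p < q" "q \<noteq> \<infinity>" and st: "0 < s" "s \<le> t"
  shows "kernel_max p q J w t * s powr real_of_ereal q \<le> kernel_max p q J w s * t powr real_of_ereal q"
proof -
  define r where "r = real_of_ereal q"
  define a where "a = kernel_max p q J w s * t powr r / s powr r"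
  have "kernel_max p q J w t \<le> a"
  proof (rule kernel_max_le[OF J(1)])
    show "0 \<le> a" using kernel_max_nonneg[OF J(1)] by (simp add: a_def)
    fix c assume c: "c \<in> J"
    have c0: "0 < c" using J c by simp
    have "kernel p q (t / c) * (s / c) powr r \<le> kernel p q (s / c) * (t / c) powr r"
      unfolding r_def using st c0 by (intro kernel_growth_q pq) (auto simp: divide_right_mono)
    then have "kernel p q (t / c) * s powr r \<le> kernel p q (s / c) * t powr r"
      using st c0 by (simp add: powr_divide field_simps)
    then have "w c * (kernel p q (t / c) * s powr r) \<le> w c * (kernel p q (s / c) * t powr r)"
      using w by (rule mult_left_mono)
    also have "\<dots> = (w c * kernel p q (s / c)) * t powr r" by simp
    also have "\<dots> \<le> kernel_max p q J w s * t powr r"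
      by (intro mult_right_mono kernel_max_ge J c) simp
    finally show "w c * kernel p q (t / c) \<le> a" using st by (simp add: a_def field_simps)
  qed
  then show ?thesis using st unfolding r_def[symmetric] by (simp add: a_def field_simps)
qed

lemma kernel_max_mono:
  assumes "finite J" "\<And>c. c \<in> J \<Longrightarrow> 0 < c" "\<And>c. 0 \<le> w c" "ereal p < q" "0 \<le> p" "0 \<le> s" "s \<le> t"
  shows "kernel_max p q J w s \<le> kernel_max p q J w t"
proof (cases "s = 0")
  case True
  then show ?thesis using assms(1) by (simp add: kernel_max_0 kernel_max_nonneg)
next
  case False
  then have s: "0 < s" using assms by simp
  have "kernel_max p q J w s * t powr p \<le> kernel_max p q J w t * s powr p"
    using assms s by (intro kernel_max_growth_p) auto
  also have "\<dots> \<le> kernel_max p q J w t * t powr p"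
    using assms s by (intro mult_left_mono powr_mono2 kernel_max_nonneg) auto
  finally show ?thesis using s assms by simp
qed

lemma measurable_kernel_max [measurable]:
  assumes "finite J" "\<And>c. c \<in> J \<Longrightarrow> 0 < c"
  shows "kernel_max p q J w \<in> borel_measurable borel"
proof -
  obtain \<sigma> where [measurable]: "\<sigma> \<in> borel_measurable borel"
    and \<sigma>: "\<And>s. kernel_max p q J w s = (\<Sum>c\<in>J. w c * (if \<sigma> s = c then kernel p q (s / c) else 0))"
    using kernel_max_selection[OF assms, where p = p and q = q and w = w] by blast
  have "(\<lambda>s. \<Sum>c\<in>J. w c * (if \<sigma> s = c then kernel p q (s / c) else 0)) \<in> borel_measurable borel"
    by measurable
  then show ?thesis unfolding \<sigma>[symmetric] .
qed

lemma integrable_selected_kernel: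
  assumes p: "1 \<le> p" "ereal p < q" and [measurable]: "S \<in> borel_measurable unit_leb" "y \<in> borel_measurable unit_leb"
    and y: "\<And>t. 0 \<le> y t" "\<And>t. y t \<le> R" and c: "0 < c"
  shows "integrable unit_leb (\<lambda>t. if S t = c then kernel p q (y t / c) else 0)"
proof (rule integrable_unit_leb_bounded)
  fix t
  have "kernel p q (y t / c) \<le> (y t / c) powr p" using y c p by (intro kernel_le_powr_p) auto
  also have "\<dots> \<le> (R / c) powr p" using y c p by (intro powr_mono2 divide_right_mono) auto
  finally show "\<bar>if S t = c then kernel p q (y t / c) else 0\<bar> \<le> (R / c) powr p"
    using kernel_nonneg by auto
qed measurable

lemma modular_mono:
  assumes "\<And>t. t \<in> {0..1} \<Longrightarrow> M \<bar>x t\<bar> \<le> L \<bar>y t\<bar>"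
  shows "modular M x \<le> modular L y"
  unfolding modular_def using assms by (intro nn_integral_mono ennreal_leI) simp

section \<open>Kernel vectors, their modular inequality and their realisation\<close>

context ri_space
begin

text \<open>The disjoint sets are encoded as the level sets of one function \<open>S\<close>.\<close>

definition kernel_vectors :: "real \<Rightarrow> ereal \<Rightarrow> real \<Rightarrow> (real \<Rightarrow> real) set" where
  "kernel_vectors p q r = {v. \<exists>y S R. y \<in> E \<and> S \<in> borel_measurable unit_leb \<and> (\<forall>t. \<bar>y t\<bar> \<le> R) \<and> N y \<le> r
     \<and> v = (\<lambda>c. \<integral>t. (if S t = c then kernel p q (\<bar>y t\<bar> / c) else 0) \<partial>unit_leb)}"

lemma norm_zero: "N (\<lambda>t. 0) = 0"
  using norm_eq_0_iff[OF zero_mem] by simp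

lemma zero_in_kernel_vectors:
  assumes "0 \<le> r" shows "(\<lambda>c. 0) \<in> kernel_vectors p q r"
  unfolding kernel_vectors_def using assms zero_mem norm_zero
  by (intro CollectI exI[of _ "\<lambda>t. 0"] exI[of _ 0]) auto

lemma modular_kernel_max_le:
  assumes p: "1 \<le> p" "ereal p < q" and J: "finite J" "\<And>c. c \<in> J \<Longrightarrow> 0 < c" and w: "\<And>c. 0 \<le> w c"
    and sep: "\<And>v. v \<in> kernel_vectors p q r \<Longrightarrow> (\<Sum>c\<in>J. w c * v c) \<le> 1"
    and y: "y \<in> E" "N y \<le> r"
  shows "modular (kernel_max p q J w) y \<le> 1"
proof -
  obtain \<sigma> where [measurable]: "\<sigma> \<in> borel_measurable borel"
    and \<sigma>: "\<And>s. kernel_max p q J w s = (\<Sum>c\<in>J. w c * (if \<sigma> s = c then kernel p q (s / c) else 0))"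
    using kernel_max_selection[OF J, where p = p and q = q and w = w] by blast
  have [measurable]: "y \<in> borel_measurable unit_leb" using y by (intro measurable)
  have [measurable]: "kernel_max p q J w \<in> borel_measurable borel" using J by measurable
  \<comment> \<open>Kernel vectors come from bounded functions, hence the truncation, which monotone
    convergence removes at the end.\<close>
  define z where "z i t = min \<bar>y t\<bar> (real i)" for i t
  have zm [measurable]: "z i \<in> borel_measurable unit_leb" for i unfolding z_def by measurable
  have zb: "0 \<le> z i t" "z i t \<le> real i" for i t by (auto simp: z_def)
  have z: "z i \<in> E" "N (z i) \<le> r" for i
    using lattice_mono[OF y(1) zm[of i]] y(2) by (auto simp: z_def)
  have bdd: "(\<integral>\<^sup>+ t. ennreal (kernel_max p q J w (z i t)) \<partial>unit_leb) \<le> 1" for i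
  proof -
    \<comment> \<open>Labelling by the maximising index makes
      \<open>\<Sum>c\<in>J. w c * v c\<close> equal to the integral of
      \<open>kernel_max\<close>.\<close>
    define v where "v c = (\<integral>t. (if \<sigma> (z i t) = c then kernel p q (z i t / c) else 0) \<partial>unit_leb)" for c
    have "v \<in> kernel_vectors p q r" unfolding kernel_vectors_def mem_Collect_eq
      by (rule exI[of _ "z i"], rule exI[of _ "\<lambda>t. \<sigma> (z i t)"], rule exI[of _ "real i"])
        (use z zb in \<open>auto simp: v_def fun_eq_iff abs_of_nonneg[OF zb(1)] cong: if_cong\<close>)
    then have le: "(\<Sum>c\<in>J. w c * v c) \<le> 1" by (rule sep)
    have int: "integrable unit_leb (\<lambda>t. if \<sigma> (z i t) = c then kernel p q (z i t / c) else 0)" if "c \<in> J" for c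
      using integrable_selected_kernel[OF p, of "\<lambda>t. \<sigma> (z i t)" "z i" "real i" c] zb J(2)[OF that] by simp
    have "(\<integral>\<^sup>+ t. ennreal (kernel_max p q J w (z i t)) \<partial>unit_leb)
      = ennreal (\<integral>t. kernel_max p q J w (z i t) \<partial>unit_leb)"
      using int kernel_max_nonneg[OF J(1), of p q w] unfolding \<sigma>
      by (intro nn_integral_eq_integral Bochner_Integration.integrable_sum integrable_mult_right) auto
    also have "(\<integral>t. kernel_max p q J w (z i t) \<partial>unit_leb) = (\<Sum>c\<in>J. w c * v c)"
      unfolding \<sigma> v_def using int by (subst Bochner_Integration.integral_sum) auto
    finally show ?thesis using le by (simp add: ennreal_le_1)
  qed
  have "(\<lambda>i. \<integral>\<^sup>+ t. ennreal (kernel_max p q J w (z i t)) \<partial>unit_leb) \<longlonglongrightarrow> modular (kernel_max p q J w) y"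
    unfolding modular_def
  proof (rule nn_integral_LIMSEQ)
    show "incseq (\<lambda>i t. ennreal (kernel_max p q J w (z i t)))"
      using p zb by (auto simp: incseq_def le_fun_def z_def intro!: ennreal_leI kernel_max_mono J w)
    \<comment> \<open>At each \<open>t\<close> the truncations eventually equal
      \<open>\<bar>y t\<bar>\<close>, which copes with the jumps of \<open>kernel_max\<close> when
      \<open>q = \<infinity>\<close>.\<close>
    show "(\<lambda>i. ennreal (kernel_max p q J w (z i t))) \<longlonglongrightarrow> ennreal (kernel_max p q J w \<bar>y t\<bar>)" for t
    proof (rule tendsto_eventually)
      obtain k where "\<bar>y t\<bar> \<le> real k" using real_arch_simple by blast
      then show "\<forall>\<^sub>F i in sequentially. ennreal (kernel_max p q J w (z i t)) = ennreal (kernel_max p q J w \<bar>y t\<bar>)"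
        by (intro eventually_sequentiallyI[of k]) (auto simp: z_def min_def)
    qed
  qed simp
  then show ?thesis using bdd by (intro LIMSEQ_le_const2) auto
qed

text \<open>The functions and the labels behind \<open>L\<close> are joined by the same dilated sum,
  so the joint vector is exactly the average \<open>v\<close>. \<open>D\<close>-convexity costs
  \<open>cD\<close>, interpolation costs \<open>cI\<close>, and the 2 undoes the halving in the
  image of \<open>Y\<close>.\<close>

lemma norm_le_of_averages:
  assumes p: "1 \<le> p" and pq: "ereal p < q"
    and D: "0 < cD" "\<forall>n\<ge>1. \<forall>x. (\<forall>k\<in>{1..n}. x k \<in> E) \<longrightarrow>
      dilated_sum n x \<in> E \<and> N (dilated_sum n x) \<le> cD * (SUP k\<in>{1..n}. N (x k))"
    and I: "0 < cI" "\<forall>T. linear_contraction p q T \<longrightarrow>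
      (\<forall>x \<in> E \<inter> Lp_space p \<inter> Lp_space q. T x \<in> E \<and> N (T x) \<le> cI * N x)"
    and J: "finite J" "\<And>c. c \<in> J \<Longrightarrow> 0 < c"
    and s: "s \<in> borel_measurable unit_leb" "AE t in unit_leb. s t \<in> insert 0 J"
    and L: "L \<noteq> []" "set L \<subseteq> kernel_vectors p q r"
    and v: "\<And>c. v c = (\<Sum>a\<leftarrow>L. a c) / real (length L)"
    and v_pos: "\<And>c. c \<in> J \<Longrightarrow> 0 < v c"
    and v_ge: "\<And>c. c \<in> J \<Longrightarrow> measure unit_leb {t \<in> {0..1}. s t = c} \<le> 2 * v c"
  shows "N s \<le> 2 * cI * cD * r"
proof -
  define n where "n = length L"
  have n: "1 \<le> n" using L by (simp add: n_def Suc_le_eq)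
  \<comment> \<open>Pieces are numbered from 1 and list entries from 0, hence the index
    \<open>k - 1\<close>.\<close>
  define G where "G k y S R \<longleftrightarrow> y \<in> E \<and> S \<in> borel_measurable unit_leb \<and> (\<forall>t. \<bar>y t\<bar> \<le> R) \<and> N y \<le> r
     \<and> L ! (k - 1) = (\<lambda>c. \<integral>t. (if S t = c then kernel p q (\<bar>y t\<bar> / c) else 0) \<partial>unit_leb)" for k y S R
  have "\<forall>k\<in>{1..n}. \<exists>y S R. G k y S R"
  proof
    fix k assume "k \<in> {1..n}"
    then have "L ! (k - 1) \<in> kernel_vectors p q r"
      using L(2) nth_mem[of "k - 1" L] by (auto simp: n_def)
    then show "\<exists>y S R. G k y S R" unfolding kernel_vectors_def G_def by blast
  qed
  from bchoice[OF this] obtain y where "\<forall>k\<in>{1..n}. \<exists>S R. G k (y k) S R" by blast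
  from bchoice[OF this] obtain S where "\<forall>k\<in>{1..n}. \<exists>R. G k (y k) (S k) R" by blast
  from bchoice[OF this] obtain R where G: "\<forall>k\<in>{1..n}. G k (y k) (S k) (R k)" by blast
  have y: "y k \<in> E" "\<bar>y k t\<bar> \<le> R k" "N (y k) \<le> r"
    and S: "S k \<in> borel_measurable unit_leb"
    and Lk: "L ! (k - 1) = (\<lambda>c. \<integral>t. (if S k t = c then kernel p q (\<bar>y k t\<bar> / c) else 0) \<partial>unit_leb)"
    if "k \<in> {1..n}" for k t
    using G that unfolding G_def by blast+
  have ym: "y k \<in> borel_measurable unit_leb" if "k \<in> {1..n}" for k using y that by (intro measurable)
  define Y where "Y = dil n (\<lambda>k t. \<bar>y k t\<bar>)"
  define Q where "Q = dil n S"
  define B where "B = (\<Sum>k=1..n. \<bar>R k\<bar>)"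
  have R: "\<bar>y k t\<bar> \<le> B" if "k \<in> {1..n}" for k t
    using y(2)[OF that, of t] member_le_sum[OF that, of "\<lambda>k. \<bar>R k\<bar>"] by (auto simp: B_def)
  have B0: "0 \<le> B" by (simp add: B_def sum_nonneg)
  have Y: "0 \<le> Y t" "Y t \<le> B" for t
    unfolding Y_def by (rule dil_cases[of n t]; use R B0 in auto)+
  have "Y = dilated_sum n y" by (simp add: Y_def dilated_sum_eq_dil)
  then have YE: "Y \<in> E" "N Y \<le> cD * (SUP k\<in>{1..n}. N (y k))" using D(2) n y(1) by auto
  have "(SUP k\<in>{1..n}. N (y k)) \<le> r" using n y by (intro cSUP_least) auto
  then have NY: "N Y \<le> cD * r" using YE D(1) by (meson less_imp_le mult_left_mono order_trans)
  have Ym: "Y \<in> borel_measurable unit_leb" using YE by (intro measurable)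
  have Qm: "Q \<in> borel_measurable unit_leb" unfolding Q_def using n S by (intro measurable_dil) auto
  \<comment> \<open>The integrand depends on label and value at the same point and vanishes at label
    0 and value 0, so it is itself a dilated sum.\<close>
  have v_eq: "v c = (\<integral>t. (if Q t = c then kernel p q (Y t / c) else 0) \<partial>unit_leb)" if "c \<in> J" for c
  proof -
    have c: "0 < c" using J that by simp
    have "(\<integral>t. (if Q t = c then kernel p q (Y t / c) else 0) \<partial>unit_leb)
       = (\<integral>t. dil n (\<lambda>k t. if S k t = c then kernel p q (\<bar>y k t\<bar> / c) else 0) t \<partial>unit_leb)"
      unfolding Q_def Y_def
      using dil_map2[of "\<lambda>a b. if a = c then kernel p q (b / c) else 0" n S "\<lambda>k t. \<bar>y k t\<bar>"] by simp
    also have "\<dots> = (\<Sum>k=1..n. \<integral>t. (if S k t = c then kernel p q (\<bar>y k t\<bar> / c) else 0) \<partial>unit_leb) / real n"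
      using R c by (intro integral_dil n integrable_selected_kernel[where R = B] p pq S borel_measurable_abs ym) auto
    also have "(\<Sum>k=1..n. \<integral>t. (if S k t = c then kernel p q (\<bar>y k t\<bar> / c) else 0) \<partial>unit_leb)
        = (\<Sum>k=1..n. (L ! (k - 1)) c)"
      by (rule sum.cong[OF refl]) (simp only: Lk)
    also have "\<dots> = (\<Sum>k<n. (L ! k) c)"
      by (rule sum.reindex_bij_witness[of _ Suc "\<lambda>k. k - 1"]) auto
    also have "\<dots> = (\<Sum>a\<leftarrow>L. a c)"
      by (simp add: sum_list_sum_nth n_def atLeast0LessThan)
    finally show ?thesis by (simp add: v n_def)
  qed
  interpret op: step_operator p q J s Q Y v B
    by unfold_locales (fact p pq J s(1) Qm Ym Y v_eq v_pos v_ge)+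
  have "1 \<le> q" using p pq by (metis ereal_less_eq(3) less_imp_le one_ereal_def order_trans)
  then have "Y \<in> E \<inter> Lp_space p \<inter> Lp_space q"
    using YE Y Ym p by (auto intro!: Lp_space_bounded[of _ B])
  then have T: "op.T Y \<in> E" "N (op.T Y) \<le> cI * N Y" using I(2) op.linear_contraction_T by blast+
  have "AE t in unit_leb. \<bar>s t\<bar> \<le> \<bar>2 * op.T Y t\<bar>"
    using s(2) by eventually_elim (auto simp: op.T_Y)
  then have "N s \<le> N (\<lambda>t. 2 * op.T Y t)"
    by (rule lattice_mono(2)[OF scale_mem[OF T(1)] s(1)])
  also have "\<dots> = 2 * N (op.T Y)" using norm_scale[OF T(1), of 2] by simp
  also have "\<dots> \<le> 2 * (cI * (cD * r))"
    using T(2) NY I(1) by (meson less_imp_le mult_left_mono order_trans zero_le_numeral)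
  finally show ?thesis by (simp add: mult.assoc)
qed

end

subsection \<open>Orlicz functions and Luxemburg norms\<close>

context ri_space
begin

lemma orlicz_minorant:
  assumes p: "1 \<le> p" and pq: "ereal p < q" and mm: "maximal_space E N \<or> minimal_space E N"
    and D: "0 < cD" "\<forall>n\<ge>1. \<forall>x. (\<forall>k\<in>{1..n}. x k \<in> E) \<longrightarrow>
      dilated_sum n x \<in> E \<and> N (dilated_sum n x) \<le> cD * (SUP k\<in>{1..n}. N (x k))"
    and I: "0 < cI" "\<forall>T. linear_contraction p q T \<longrightarrow>
      (\<forall>x \<in> E \<inter> Lp_space p \<inter> Lp_space q. T x \<in> E \<and> N (T x) \<le> cI * N x)"
    and r: "0 < r" "8 * cI * cD * r \<le> 1"
    and x: "x \<in> E" "N x = 1"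
  shows "\<exists>M. increasing_from_0 M \<and> p_convex p M \<and> q_concave q M \<and>
    1 \<le> modular M x \<and> (\<forall>y\<in>E. N y \<le> r \<longrightarrow> modular M y \<le> 1)"
proof -
  interpret finite_measure unit_leb by (rule finite_measure_unit_leb)
  have xm [measurable]: "x \<in> borel_measurable unit_leb" using x by (intro measurable)
  \<comment> \<open>Halving \<open>x\<close> anticipates the loss in
    \<open>M (s / 2) \<le> L s\<close> when \<open>M\<close> is regularised.\<close>
  define u where "u t = \<bar>1 / 2 * x t\<bar>" for t
  have um [measurable]: "u \<in> borel_measurable unit_leb" unfolding u_def by measurable
  have uE: "u \<in> E"
    using lattice_mono(1)[OF scale_mem[OF x(1), of "1 / 2"] um] by (simp add: u_def)
  have "N (\<lambda>t. 1 / 2 * x t) \<le> N u"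
    by (rule lattice_mono(2)[OF uE]) (auto simp: u_def)
  then have Nu: "1 / 2 \<le> N u" using norm_scale[OF x(1), of "1 / 2"] x by simp
  obtain U where U: "incseq U" "\<And>i. simple_function unit_leb (U i)"
      "\<And>t. bdd_above (range (\<lambda>i. U i t))" "\<And>i t. 0 \<le> U i t" "u = (SUP i. U i)"
    using borel_measurable_implies_simple_function_sequence_real[OF um] by (auto simp: u_def)
  have Um: "U i \<in> borel_measurable unit_leb" for i using U(2) by (rule borel_measurable_simple_function)
  have Uinc: "incseq (\<lambda>i. U i t)" for t using U(1) by (auto simp: incseq_def le_fun_def)
  have u_eq: "u t = (SUP i. U i t)" for t using U(5) by (simp add: image_comp o_def)
  have lim: "(\<lambda>i. U i t) \<longlonglongrightarrow> u t" for t
    unfolding u_eq by (rule LIMSEQ_incseq_SUP[OF U(3) Uinc])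
  have Ule: "U i t \<le> u t" for i t unfolding u_eq using U(3) by (intro cSUP_upper) auto
  have UE: "U i \<in> E" for i
    by (rule lattice_mono(1)[OF uE Um]) (use U(4) Ule in \<open>auto simp: u_def\<close>)
  obtain i where i: "1 / 4 < N (U i)"
    using fatou_norm[OF mm uE UE U(4) Uinc lim, of "1 / 4"] Nu by auto
  define s where "s = U i"
  have sm [measurable]: "s \<in> borel_measurable unit_leb" unfolding s_def by (rule Um)
  define b where "b c = measure unit_leb {t \<in> {0..1}. s t = c}" for c
  \<comment> \<open>Values taken on null sets are dropped, so that \<open>b\<close> is positive on
    \<open>J\<close> and a positive gap \<open>e\<close> exists.\<close>
  define J where "J = {c \<in> s ` {0..1}. 0 < c \<and> 0 < b c}"
  have fin: "finite (s ` {0..1})" using simple_functionD(1)[OF U(2)[of i]] by (simp add: s_def)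
  have J: "finite J" "\<And>c. c \<in> J \<Longrightarrow> 0 < c" "\<And>c. c \<in> J \<Longrightarrow> 0 < b c"
    using fin by (auto simp: J_def)
  have sets: "{t \<in> {0..1}. s t = c} \<in> sets unit_leb" for c
    using measurable_sets[OF sm, of "{c}"] by (simp add: vimage_def Int_def conj_commute)
  have ae: "AE t in unit_leb. s t \<in> insert 0 J"
  proof -
    have "AE t in unit_leb. s t \<noteq> c" if "c \<in> s ` {0..1} - insert 0 J" for c
    proof -
      have "0 \<le> c" using that U(4) by (auto simp: s_def)
      then have "b c = 0" using that measure_nonneg[of unit_leb] unfolding J_def b_def
        by (auto simp: order_less_le)
      then have "{t \<in> {0..1}. s t = c} \<in> null_sets unit_leb"
        using sets[of c] by (intro null_setsI) (simp_all add: b_def emeasure_eq_measure)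
      from AE_not_in[OF this] AE_space[of unit_leb] show ?thesis by eventually_elim auto
    qed
    then have "AE t in unit_leb. \<forall>c\<in>s ` {0..1} - insert 0 J. s t \<noteq> c"
      using fin by (intro AE_finite_allI) auto
    with AE_space[of unit_leb] show ?thesis by eventually_elim auto
  qed
  define V where "V = {v. \<exists>L. L \<noteq> [] \<and> set L \<subseteq> kernel_vectors p q r
    \<and> v = (\<lambda>i. (\<Sum>a\<leftarrow>L. a i) / real (length L))}"
  have VI: "v \<in> V" if "v \<in> kernel_vectors p q r" for v
    unfolding V_def using that by (intro CollectI exI[of _ "[v]"]) auto
  \<comment> \<open>Failure of the gap then gives \<open>v c > b c / 2\<close> for every
    \<open>c\<close> in \<open>J\<close>, which is the case \<open>b \<le> 2 * v\<close>. The 1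
    covers empty \<open>J\<close>.\<close>
  define e where "e = Min (insert 1 (b ` J)) / 2"
  have e0: "0 < e" using J by (auto simp: e_def)
  have eb: "e \<le> b c / 2" if "c \<in> J" for c using J that unfolding e_def by (auto intro!: divide_right_mono Min_le)
  have far: "\<exists>c\<in>J. v c \<le> b c - e" if v: "v \<in> V" for v
  proof (rule ccontr)
    assume "\<not> ?thesis"
    then have vb: "b c / 2 < v c" if "c \<in> J" for c using eb[OF that] that by fastforce
    obtain L where L: "L \<noteq> []" "set L \<subseteq> kernel_vectors p q r"
      and vL: "\<And>c. v c = (\<Sum>a\<leftarrow>L. a c) / real (length L)" using v unfolding V_def by blast
    \<comment> \<open>By the choice of \<open>r\<close> the right side is at most 1/4, while
      \<open>N s > 1 / 4\<close>.\<close>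
    have "N s \<le> 2 * cI * cD * r"
    proof (rule norm_le_of_averages[OF p pq D I J(1,2) sm ae L vL])
      show "0 < v c" if "c \<in> J" for c using vb[OF that] J(3)[OF that] by simp
      show "measure unit_leb {t \<in> {0..1}. s t = c} \<le> 2 * v c" if "c \<in> J" for c
        using vb[OF that] by (simp add: b_def)
    qed
    then show False using r i unfolding s_def by simp
  qed
  have mid: "(\<lambda>i. (v i + v' i) / 2) \<in> V" if "v \<in> V" "v' \<in> V" for v v'
    using that unfolding V_def by (rule averages_midpoint)
  have "(\<lambda>c. 0) \<in> V" using r by (intro VI zero_in_kernel_vectors) simp
  from midpoint_separation[OF J(1) this mid e0 far]
  obtain w where w: "\<And>c. 0 \<le> w c" "(\<Sum>c\<in>J. w c * b c) = 1"
      "\<And>v. v \<in> V \<Longrightarrow> (\<Sum>c\<in>J. w c * v c) \<le> 1"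
    by blast
  define M where "M = kernel_max p q J w"
  have M0: "M 0 = 0" unfolding M_def by (rule kernel_max_0[OF J(1)])
  have Mnn: "0 \<le> M a" for a unfolding M_def by (rule kernel_max_nonneg[OF J(1)])
  have Mp: "M a * c powr p \<le> M c * a powr p" if "0 < a" "a \<le> c" for a c
    unfolding M_def by (rule kernel_max_growth_p[OF J(1,2) w(1) pq that])
  have Mq: "M c * a powr real_of_ereal q \<le> M a * c powr real_of_ereal q"
    if "q \<noteq> \<infinity>" "0 < a" "a \<le> c" for a c
    unfolding M_def by (rule kernel_max_growth_q[OF J(1,2) w(1) pq that])
  obtain L where L: "increasing_from_0 L" "p_convex p L" "q_concave q L"
      "\<And>s. 0 \<le> s \<Longrightarrow> M (s / 2) \<le> L s" "\<And>s. 0 \<le> s \<Longrightarrow> L s \<le> M s"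
    using p_convex_q_concave_regularisation[of p q M, OF p pq M0 Mnn Mp Mq] by blast
  \<comment> \<open>Since \<open>kernel p q 1 = 1\<close>, \<open>M c \<ge> w c\<close> for
    \<open>c\<close> in \<open>J\<close>. Hence \<open>M (s t)\<close> dominates a step function
    with integral \<open>\<Sum>c\<in>J. w c * b c = 1\<close>.\<close>
  have "1 \<le> modular L x"
  proof -
    have "1 = ennreal (\<Sum>c\<in>J. w c * b c)" using w by simp
    also have "(\<Sum>c\<in>J. w c * b c) = (\<integral>t. (\<Sum>c\<in>J. w c * indicator {t \<in> {0..1}. s t = c} t) \<partial>unit_leb)"
    proof (subst Bochner_Integration.integral_sum)
      have "{t \<in> {0..1}. s t = c} \<inter> space unit_leb = {t \<in> {0..1}. s t = c}" for c by auto
      then show "(\<Sum>c\<in>J. w c * b c)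
        = (\<Sum>c\<in>J. \<integral>t. w c * indicator {t \<in> {0..1}. s t = c} t \<partial>unit_leb)"
        by (simp only: integral_mult_right_zero Bochner_Integration.integral_indicator b_def)
      show "integrable unit_leb (\<lambda>t. w c * indicator {t \<in> {0..1}. s t = c} t)" for c
        by (intro integrable_mult_right integrable_real_indicator sets) (simp add: less_top[symmetric])
    qed
    also have "ennreal \<dots> = (\<integral>\<^sup>+t. ennreal (\<Sum>c\<in>J. w c * indicator {t \<in> {0..1}. s t = c} t) \<partial>unit_leb)"
      using w(1) by (intro nn_integral_eq_integral[symmetric] Bochner_Integration.integrable_sum
          integrable_mult_right integrable_real_indicator sets AE_I2 sum_nonneg)
        (auto simp: less_top[symmetric])
    also have "\<dots> \<le> modular L x"
      unfolding modular_def
    proof (intro nn_integral_mono ennreal_leI)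
      fix t assume "t \<in> space unit_leb"
      then have t: "t \<in> {0..1}" by simp
      have "(\<Sum>c\<in>J. w c * indicator {t \<in> {0..1}. s t = c} t) = (\<Sum>c\<in>J. if s t = c then w (s t) else 0)"
        using t by (intro sum.cong) auto
      also have "\<dots> = (if s t \<in> J then w (s t) else 0)" using J(1) by simp
      also have "\<dots> \<le> M (s t)"
      proof (cases "s t \<in> J")
        case True
        then have "w (s t) * kernel p q (s t / s t) \<le> M (s t)"
          unfolding M_def by (intro kernel_max_ge J(1))
        then show ?thesis using True J(2)[OF True] by simp
      qed (simp add: Mnn)
      also have "\<dots> \<le> M (u t)"
        unfolding M_def using U(4) Ule p by (intro kernel_max_mono J w pq) (auto simp: s_def)
      also have "u t = \<bar>x t\<bar> / 2" by (simp add: u_def abs_mult)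
      also have "M (\<bar>x t\<bar> / 2) \<le> L \<bar>x t\<bar>" by (intro L(4)) simp
      finally show "(\<Sum>c\<in>J. w c * indicator {t \<in> {0..1}. s t = c} t) \<le> L \<bar>x t\<bar>" .
    qed
    finally show ?thesis .
  qed
  moreover have "modular L y \<le> 1" if "y \<in> E" "N y \<le> r" for y
  proof -
    have "modular L y \<le> modular M y" by (intro modular_mono L(5)) simp
    also have "\<dots> \<le> 1"
      unfolding M_def by (rule modular_kernel_max_le[OF p pq J(1,2) w(1) w(3)[OF VI] that])
    finally show ?thesis .
  qed
  ultimately show ?thesis using L by blast
qed

end

section \<open>Scaling of modulars and comparison with Luxemburg norms\<close>

lemma p_convex_scale:
  assumes "1 \<le> p" "p_convex p M" "increasing_from_0 M" "0 \<le> \<theta>" "\<theta> \<le> 1" "0 \<le> s"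
  shows "M (\<theta> * s) \<le> \<theta> * M s"
proof -
  have cv: "convex_on {0..} (\<lambda>t. M (t powr (1 / p)))" using assms by (simp add: p_convex_def)
  have M0: "M 0 = 0" and mono: "mono_on {0..} M" using assms by (auto simp: increasing_from_0_def)
  define u where "u = s powr p"
  have u: "u powr (1 / p) = s" using assms by (simp add: u_def powr_powr)
  \<comment> \<open>Enlarging \<open>\<theta>\<close> to \<open>\<theta> powr (1 / p)\<close> turns
    the scaling into multiplication by \<open>\<theta>\<close> in the variable
    \<open>s powr p\<close>, where convexity and \<open>M 0 = 0\<close> apply.\<close>
  have "\<theta> \<le> \<theta> powr (1 / p)"
    using powr_mono'[of "1 / p" 1 \<theta>] assms by (cases "\<theta> = 0") auto
  then have "M (\<theta> * s) \<le> M (\<theta> powr (1 / p) * s)"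
    using assms by (intro mono_onD[OF mono] mult_right_mono) auto
  also have "\<dots> = M (((1 - \<theta>) *\<^sub>R 0 + \<theta> *\<^sub>R u) powr (1 / p))"
    using assms u by (simp add: powr_mult u_def)
  also have "\<dots> \<le> (1 - \<theta>) * M (0 powr (1 / p)) + \<theta> * M (u powr (1 / p))"
    using assms by (intro convex_onD[OF cv]) (auto simp: u_def)
  finally show ?thesis using u M0 by simp
qed

lemma modular_scale:
  assumes p: "1 \<le> p" "p_convex p M" and M: "increasing_from_0 M" and \<theta>: "0 \<le> \<theta>" "\<theta> \<le> 1"
    and [measurable]: "x \<in> borel_measurable unit_leb"
  shows "modular M (\<lambda>t. \<theta> * x t) \<le> ennreal \<theta> * modular M x"
proof -
  have Mn: "0 \<le> M \<bar>a\<bar>" for a using M by (simp add: increasing_from_0_def)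
  \<comment> \<open>\<open>M\<close> is monotone on the half-line only; the constant extension to
    the left is monotone everywhere, hence Borel.\<close>
  have "mono (\<lambda>a. M (max a 0))"
    using M unfolding increasing_from_0_def by (auto intro!: monoI intro: mono_onD)
  then have [measurable]: "(\<lambda>a. M (max a 0)) \<in> borel_measurable borel" by (rule borel_measurable_mono)
  have "(\<lambda>t. M (max \<bar>x t\<bar> 0)) \<in> borel_measurable unit_leb" by measurable
  then have meas: "(\<lambda>t. M \<bar>x t\<bar>) \<in> borel_measurable unit_leb" by simp
  have "modular M (\<lambda>t. \<theta> * x t) \<le> (\<integral>\<^sup>+ t. ennreal \<theta> * ennreal (M \<bar>x t\<bar>) \<partial>unit_leb)"
    unfolding modular_def
  proof (intro nn_integral_mono)
    fix t
    have "M \<bar>\<theta> * x t\<bar> \<le> \<theta> * M \<bar>x t\<bar>"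
      using p_convex_scale[OF p M \<theta>, of "\<bar>x t\<bar>"] \<theta> by (simp add: abs_mult)
    then show "ennreal (M \<bar>\<theta> * x t\<bar>) \<le> ennreal \<theta> * ennreal (M \<bar>x t\<bar>)"
      using Mn \<theta> by (simp add: ennreal_mult[symmetric] ennreal_leI)
  qed
  also have "\<dots> = ennreal \<theta> * modular M x"
    unfolding modular_def using meas by (intro nn_integral_cmult) auto
  finally show ?thesis .
qed

context ri_space
begin

lemma luxemburg_norm_upper:
  assumes p: "1 \<le> p" "p_convex p M" and M: "increasing_from_0 M" and c: "1 \<le> c"
    and bd: "\<And>y. y \<in> E \<Longrightarrow> N y \<le> 1 / c \<Longrightarrow> modular M y \<le> ennreal c" and x: "x \<in> E"
  shows "luxemburg_norm M x \<le> ennreal (c\<^sup>2 * N x)"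
proof (rule ennreal_le_epsilon)
  fix e :: real assume e: "0 < e"
  \<comment> \<open>The summand \<open>e\<close> keeps \<open>l\<close> positive when
    \<open>N x = 0\<close>. One factor \<open>c\<close> brings \<open>c / l * x\<close> into the
    ball of radius \<open>1 / c\<close>; the other scales its modular from \<open>c\<close> down to
    1.\<close>
  define l where "l = c\<^sup>2 * N x + e"
  have l: "0 < l" using e norm_nonneg[OF x] by (simp add: l_def add_nonneg_pos)
  define z where "z t = c / l * x t" for t
  have zE: "z \<in> E" unfolding z_def by (rule scale_mem[OF x])
  have "N z = c / l * N x" unfolding z_def using norm_scale[OF x, of "c / l"] l c by simp
  also have "\<dots> \<le> 1 / c"
    using l c e by (simp add: field_simps l_def power2_eq_square)
  finally have zc: "modular M z \<le> ennreal c" by (rule bd[OF zE])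
  have "modular M (\<lambda>t. x t / l) = modular M (\<lambda>t. 1 / c * z t)" using c by (simp add: z_def)
  also have "\<dots> \<le> ennreal (1 / c) * modular M z"
    using c measurable[OF zE] by (intro modular_scale[OF p M]) auto
  also have "\<dots> \<le> ennreal (1 / c) * ennreal c" by (intro mult_left_mono zc) simp
  also have "\<dots> = 1" using c by (simp add: ennreal_mult[symmetric])
  finally have "modular M (\<lambda>t. x t / l) \<le> 1" .
  then have "luxemburg_norm M x \<le> ennreal l"
    unfolding luxemburg_norm_def using l by (intro INF_lower) auto
  then show "luxemburg_norm M x \<le> ennreal (c\<^sup>2 * N x) + ennreal e"
    using e norm_nonneg[OF x] by (simp add: l_def)
qed

text \<open>If an admissible \<open>l\<close> were below \<open>N x / (2 * c)\<close>, scaling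
  \<open>x / l\<close> by \<open>l / N x\<close> would give the normalised \<open>x\<close> a
  modular below \<open>1 / c\<close>.\<close>

lemma luxemburg_norm_lower:
  assumes p: "1 \<le> p" "p_convex p M" and M: "increasing_from_0 M" and c: "1 \<le> c"
    and x: "x \<in> E" "0 < N x" and lb: "ennreal (1 / c) \<le> modular M (\<lambda>t. 1 / N x * x t)"
  shows "ennreal (1 / (2 * c) * N x) \<le> luxemburg_norm M x"
  unfolding luxemburg_norm_def
proof (intro INF_greatest ennreal_leI)
  fix l assume "l \<in> {l. 0 < l \<and> modular M (\<lambda>t. x t / l) \<le> 1}"
  then have l: "0 < l" "modular M (\<lambda>t. x t / l) \<le> 1" by auto
  show "1 / (2 * c) * N x \<le> l"
  proof (rule ccontr)
    assume "\<not> ?thesis"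
    then have lt: "l / N x < 1 / (2 * c)" using x c by (simp add: field_simps)
    moreover have "1 / (2 * c) \<le> 1" using c by simp
    ultimately have le1: "l / N x \<le> 1" by linarith
    have "ennreal (1 / c) \<le> modular M (\<lambda>t. l / N x * (x t / l))" using lb l by simp
    also have "\<dots> \<le> ennreal (l / N x) * modular M (\<lambda>t. x t / l)"
      using l x le1 measurable[OF x(1)] by (intro modular_scale[OF p M]) auto
    also have "\<dots> \<le> ennreal (l / N x) * 1" by (intro mult_left_mono l) simp
    finally have "1 / c \<le> l / N x" using l x by (simp add: ennreal_le_iff)
    moreover have "1 / (2 * c) < 1 / c" using c by (simp add: field_simps)
    ultimately show False using lt by linarith
  qed
qed

lemma orlicz_family:
  assumes p: "1 \<le> p" and c: "1 \<le> c"
    and ex: "\<And>x. x \<in> E \<Longrightarrow> N x = 1 \<Longrightarrow> \<exists>M. increasing_from_0 M \<and> p_convex p M \<and> q_concave q M \<and>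
      ennreal (1 / c) \<le> modular M x \<and> (\<forall>y\<in>E. N y \<le> 1 / c \<longrightarrow> modular M y \<le> ennreal c)"
  shows "\<exists>F. (\<forall>M\<in>F. increasing_from_0 M \<and> p_convex p M \<and> q_concave q M) \<and>
    (\<exists>a>0. \<exists>b>0. \<forall>x\<in>E. ennreal (a * N x) \<le> (SUP M\<in>F. luxemburg_norm M x) \<and>
      (SUP M\<in>F. luxemburg_norm M x) \<le> ennreal (b * N x))"
proof -
  \<comment> \<open>Taking every function with the uniform upper bound avoids choosing one for each
    \<open>x\<close>; \<open>ex\<close> supplies a member that is large at the normalised
    \<open>x\<close>.\<close>
  define F where "F = {M. increasing_from_0 M \<and> p_convex p M \<and> q_concave q M \<and>
    (\<forall>y\<in>E. N y \<le> 1 / c \<longrightarrow> modular M y \<le> ennreal c)}"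
  have "ennreal (1 / (2 * c) * N x) \<le> (SUP M\<in>F. luxemburg_norm M x)" if x: "x \<in> E" for x
  proof (cases "N x = 0")
    case False
    then have Nx: "0 < N x" using norm_nonneg[OF x] by simp
    have "N (\<lambda>t. 1 / N x * x t) = 1" using norm_scale[OF x, of "1 / N x"] Nx by simp
    from ex[OF scale_mem[OF x] this] obtain M where "M \<in> F" "increasing_from_0 M" "p_convex p M"
      "ennreal (1 / c) \<le> modular M (\<lambda>t. 1 / N x * x t)" unfolding F_def by blast
    then show ?thesis using luxemburg_norm_lower[OF p _ _ c x Nx] by (meson SUP_upper order_trans)
  qed simp
  moreover have "(SUP M\<in>F. luxemburg_norm M x) \<le> ennreal (c\<^sup>2 * N x)" if x: "x \<in> E" for x
    by (intro SUP_least luxemburg_norm_upper[OF p _ _ c _ x]) (auto simp: F_def)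
  ultimately show ?thesis
    using c by (intro exI[of _ F] conjI exI[of _ "1 / (2 * c)"] exI[of _ "c\<^sup>2"]) (auto simp: F_def)
qed

end

theorem theorem21:
  fixes E :: "(real \<Rightarrow> real) set" and N :: "(real \<Rightarrow> real) \<Rightarrow> real"
    and p :: real and q :: ereal
  assumes "1 \<le> p" and "ereal p < q"
    and "ri_space E N"
    and "maximal_space E N \<or> minimal_space E N"
    and "D_convex E N"
    and "interpolation_space E N (ereal p) q"
  shows "(\<exists>c>0. \<forall>x\<in>E. N x = 1 \<longrightarrow>
            (\<exists>M. increasing_from_0 M \<and> p_convex p M \<and> q_concave q M \<and>
                 modular M x \<ge> ennreal (1 / c) \<and>
                 (\<forall>y\<in>E. N y \<le> 1 / c \<longrightarrow> modular M y \<le> ennreal c)))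
       \<and> (\<exists>F. (\<forall>M\<in>F. increasing_from_0 M \<and> p_convex p M \<and> q_concave q M) \<and>
             (\<exists>a>0. \<exists>b>0. \<forall>x\<in>E.
                ennreal (a * N x) \<le> (SUP M\<in>F. luxemburg_norm M x) \<and>
                (SUP M\<in>F. luxemburg_norm M x) \<le> ennreal (b * N x)))"
proof -
  interpret ri_space E N by fact
  obtain cD where D: "0 < cD" "\<forall>n\<ge>1. \<forall>x. (\<forall>k\<in>{1..n}. x k \<in> E) \<longrightarrow>
      dilated_sum n x \<in> E \<and> N (dilated_sum n x) \<le> cD * (SUP k\<in>{1..n}. N (x k))"
    using assms(5) unfolding D_convex_def by blast
  obtain cI where I: "0 < cI" "\<forall>T. linear_contraction p q T \<longrightarrow>
      (\<forall>x \<in> E \<inter> Lp_space p \<inter> Lp_space q. T x \<in> E \<and> N (T x) \<le> cI * N x)"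
    using assms(6) unfolding interpolation_space_def by blast
  \<comment> \<open>The second entry makes \<open>1 / c\<close> an admissible radius; the first
    gives \<open>1 / c \<le> 1 \<le> c\<close>, so modular bounds by 1 suffice.\<close>
  define c where "c = max 1 (8 * cI * cD)"
  have c: "1 \<le> c" "8 * cI * cD * (1 / c) \<le> 1" by (auto simp: c_def)
  have ex: "\<exists>M. increasing_from_0 M \<and> p_convex p M \<and> q_concave q M \<and>
      ennreal (1 / c) \<le> modular M x \<and> (\<forall>y\<in>E. N y \<le> 1 / c \<longrightarrow> modular M y \<le> ennreal c)"
    if x: "x \<in> E" "N x = 1" for x
  proof -
    have "0 < 1 / c" using c by simp
    from orlicz_minorant[OF assms(1,2,4) D I this c(2) x]
    obtain M where M: "increasing_from_0 M" "p_convex p M" "q_concave q M" "1 \<le> modular M x"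
      "\<And>y. y \<in> E \<Longrightarrow> N y \<le> 1 / c \<Longrightarrow> modular M y \<le> 1" by blast
    have "ennreal (1 / c) \<le> 1" "1 \<le> ennreal c" using c by (auto simp: ennreal_le_1 ennreal_ge_1)
    with M show ?thesis by (meson order_trans)
  qed
  have "0 < c" using c by simp
  then show ?thesis using ex orlicz_family[OF assms(1) c(1) ex] by blast
qed

end
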